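(* The space $\mathfrak m\mathrm{MR}$ is a bialgebra with product $*$, coproduct $\Delta$, unit $\eta$, and counit $\varepsilon$.
   Context: An $\mathfrak m$-permutation of $[n]$ is a word $w$ in the alphabet $1,\dots,n$, using every letter of $[n]$, such that no two consecutive letters of $w$ are equal; $\ell(w)$ is its number of letters. $S^{\mathfrak m}_n$ is the set of these, $S^{\mathfrak m}_0=\{\emptyset\}$, $S^{\mathfrak m}_\infty=\bigcup_{n\ge0}S^{\mathfrak m}_n$. $\mathfrak m\mathrm{MR}=\prod_{w\in S^{\mathfrak m}_\infty}\mathbb Z w$ is the $\mathbb Z$-module of arbitrary (possibly infinite) $\mathbb Z$-linear combinations of $\mathfrak m$-permutations. Maps are extended by linearity and continuity, i.e. so as to respect infinite linear combinations, and tensor products are completed accordingly (arbitrary $\mathbb Z$-linear combinations of $u\otimes v$, $u,v\in S^{\mathfrak m}_\infty$). Product: a word $w_1\cdots w_m$ is a multiword of $u=u_1\cdots u_k$ if there is a surjective non-decreasing $t:[m]\to[k]$ with $w_j=u_{t(j)}$. For words $u=u_1\cdots u_k$, $v=v_1\cdots v_l$ with all letters distinct, a multishuffle of $u,v$ is a word $w$ in the letters $u_i,v_j$ with no two consecutive letters equal whose restrictions to $\{u_i\}$ and to $\{v_j\}$ are multiwords of $u$ and $v$ respectively; $u\star v$ is the sum of all multishuffles. For words $x,y$ of lengths $k,l$ with possibly repeated letters, $x\star y$ is obtained from such $u\star v$ by substituting $u_i\mapsto x_i$, $v_j\mapsto y_j$. For $w=w_1\cdots w_k\in S^{\mathfrak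 m}_n$ and $u=u_1\cdots u_l\in S^{\mathfrak m}_m$, $w*u=(w_1\cdots w_k)\star\big((u_1+n)\cdots(u_l+n)\big)$. Coproduct: for a word $a=a_1\cdots a_n$ let $\blacktriangle(a)=\sum_{i=0}^n a_1\cdots a_i\otimes a_{i+1}\cdots a_n+\sum_{i=1}^n a_1\cdots a_i\otimes a_i\cdots a_n$. For a word $w$ of positive integers with no two consecutive letters equal, $\mathrm{st}(w)$ is the unique $u\in S^{\mathfrak m}_\infty$ of the same length with $w_i\le w_j\iff u_i\le u_j$ for all $i,j$. Then $\Delta(w)=\mathrm{st}(\blacktriangle w)$, where $\mathrm{st}$ is applied to both tensor factors. Unit $\eta(n)=n\,\emptyset$; counit $\varepsilon$ takes the coefficient of $\emptyset$. *)

theory Defs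
  imports Main "HOL-Library.Groups_Big_Fun"
begin

section \<open>Complete free modules and their maps\<close>

text \<open>
  The module of arbitrary, possibly infinite, integer linear combinations of the elements
  of \<open>S\<close> is the set of functions \<open>f\<close> to the integers supported on \<open>S\<close>; \<open>f\<close> stands for
  the sum of all \<open>f a \<cdot> a\<close>. The completed tensor product of the modules over \<open>S\<close> and
  \<open>T\<close> is the module over \<open>S \<times> T\<close>, and the ground ring is the module over the one-element
  type \<^typ>\<open>unit\<close>.
\<close>

definition cfree :: "'a set \<Rightarrow> ('a \<Rightarrow> int) set" where
  "cfree S = {f. \<forall>a. f a \<noteq> 0 \<longrightarrow> a \<in> S}"

definition basis :: "'a \<Rightarrow> 'a \<Rightarrow> int" where
  "basis a = (\<lambda>b. if b = a then 1 else 0)"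

text \<open>
  \<open>F\<close> respects infinite linear combinations: the image of the sum of all \<open>c a \<cdot> a\<close> is the
  sum of all \<open>c a \<cdot> F a\<close>, and each coefficient of the latter is a finite sum. For maps between
  such modules this is the same as being additive and continuous for the product
  topologies (integers discrete).
\<close>

definition continuous_linear ::
    "'a set \<Rightarrow> 'b set \<Rightarrow> (('a \<Rightarrow> int) \<Rightarrow> ('b \<Rightarrow> int)) \<Rightarrow> bool" where
  "continuous_linear S T F \<longleftrightarrow>
     (\<forall>c \<in> cfree S. F c \<in> cfree T \<and>
        (\<forall>b. finite {a. c a * F (basis a) b \<noteq> 0} \<and>
             F c b = Sum_any (\<lambda>a. c a * F (basis a) b)))"

text \<open>
  Extension by linearity and continuity of a map given on basis elements. \<^const>\<open>Sum_any\<close>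
  is 0 on families with infinite support; that this case does not arise is part of
  \<^const>\<open>continuous_linear\<close>.
\<close>

definition extend :: "('a \<Rightarrow> 'b \<Rightarrow> int) \<Rightarrow> ('a \<Rightarrow> int) \<Rightarrow> ('b \<Rightarrow> int)" where
  "extend K c = (\<lambda>b. Sum_any (\<lambda>a. c a * K a b))"

definition tensor :: "('a \<Rightarrow> int) \<Rightarrow> ('b \<Rightarrow> int) \<Rightarrow> ('a \<times> 'b \<Rightarrow> int)" where
  "tensor f g = (\<lambda>(a, b). f a * g b)"

definition tensor_map ::
    "(('a \<Rightarrow> int) \<Rightarrow> ('c \<Rightarrow> int)) \<Rightarrow> (('b \<Rightarrow> int) \<Rightarrow> ('d \<Rightarrow> int)) \<Rightarrow>
     ('a \<times> 'b \<Rightarrow> int) \<Rightarrow> ('c \<times> 'd \<Rightarrow> int)" where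
  "tensor_map F G = extend (\<lambda>(a, b). tensor (F (basis a)) (G (basis b)))"

definition reassoc :: "(('a \<times> 'b) \<times> 'c \<Rightarrow> int) \<Rightarrow> ('a \<times> ('b \<times> 'c) \<Rightarrow> int)" where
  "reassoc t = (\<lambda>(a, (b, c)). t ((a, b), c))"

definition swap_middle ::
    "(('a \<times> 'b) \<times> ('c \<times> 'd) \<Rightarrow> int) \<Rightarrow> (('a \<times> 'c) \<times> ('b \<times> 'd) \<Rightarrow> int)" where
  "swap_middle t = (\<lambda>((a, c), (b, d)). t ((a, b), (c, d)))"

section \<open>Bialgebras on complete free modules\<close>

text \<open>
  The usual axioms over the integers, with completed tensor products and continuous
  linear structure maps. In the (co)unit axioms the canonical isomorphisms of the module
  with its tensor products with the ground ring are suppressed.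
\<close>

locale completed_algebra =
  fixes S :: "'a set"
    and mult :: "('a \<times> 'a \<Rightarrow> int) \<Rightarrow> ('a \<Rightarrow> int)"
    and unit :: "int \<Rightarrow> ('a \<Rightarrow> int)"
  assumes mult_continuous_linear: "continuous_linear (S \<times> S) S mult"
    and unit_continuous_linear: "continuous_linear (UNIV :: unit set) S (\<lambda>c. unit (c ()))"
    and mult_assoc: "\<And>t. t \<in> cfree ((S \<times> S) \<times> S) \<Longrightarrow>
          mult (tensor_map mult id t) = mult (tensor_map id mult (reassoc t))"
    and unit_left: "\<And>n x. x \<in> cfree S \<Longrightarrow> mult (tensor (unit n) x) = (\<lambda>a. n * x a)"
    and unit_right: "\<And>n x. x \<in> cfree S \<Longrightarrow> mult (tensor x (unit n)) = (\<lambda>a. n * x a)"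

locale completed_coalgebra =
  fixes S :: "'a set"
    and comult :: "('a \<Rightarrow> int) \<Rightarrow> ('a \<times> 'a \<Rightarrow> int)"
    and counit :: "('a \<Rightarrow> int) \<Rightarrow> int"
  assumes comult_continuous_linear: "continuous_linear S (S \<times> S) comult"
    and counit_continuous_linear:
          "continuous_linear S (UNIV :: unit set) (\<lambda>x _. counit x)"
    and comult_coassoc: "\<And>x. x \<in> cfree S \<Longrightarrow>
          reassoc (tensor_map comult id (comult x)) = tensor_map id comult (comult x)"
    and counit_left: "\<And>x. x \<in> cfree S \<Longrightarrow>
          extend (\<lambda>(a, b) c. counit (basis a) * basis b c) (comult x) = x"
    and counit_right: "\<And>x. x \<in> cfree S \<Longrightarrow>
          extend (\<lambda>(a, b) c. basis a c * counit (basis b)) (comult x) = x"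

locale completed_bialgebra =
  completed_algebra S mult unit + completed_coalgebra S comult counit
  for S :: "'a set"
    and mult :: "('a \<times> 'a \<Rightarrow> int) \<Rightarrow> ('a \<Rightarrow> int)"
    and unit :: "int \<Rightarrow> ('a \<Rightarrow> int)"
    and comult :: "('a \<Rightarrow> int) \<Rightarrow> ('a \<times> 'a \<Rightarrow> int)"
    and counit :: "('a \<Rightarrow> int) \<Rightarrow> int" +
  assumes comult_mult: "\<And>t. t \<in> cfree (S \<times> S) \<Longrightarrow>
          comult (mult t) =
          tensor_map mult mult (swap_middle (tensor_map comult comult t))"
    and counit_mult: "\<And>t. t \<in> cfree (S \<times> S) \<Longrightarrow>
          counit (mult t) =
          Sum_any (\<lambda>(a, b). t (a, b) * (counit (basis a) * counit (basis b)))"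
    and comult_unit: "comult (unit 1) = tensor (unit 1) (unit 1)"
    and counit_unit: "\<And>n. counit (unit n) = n"

section \<open>The structure on m-permutations\<close>

definition mperms :: "nat \<Rightarrow> nat list set" where
  "mperms n = {w. set w = {1..n} \<and> distinct_adj w}"

definition all_mperms :: "nat list set" where
  "all_mperms = (\<Union>n. mperms n)"

definition is_multiword :: "'a list \<Rightarrow> 'a list \<Rightarrow> bool" where
  "is_multiword w u \<longleftrightarrow>
     (\<exists>t :: nat \<Rightarrow> nat. mono_on {..<length w} t \<and> t ` {..<length w} = {..<length u} \<and>
        (\<forall>j < length w. w ! j = u ! t j))"

text \<open>Only meant for \<open>u\<close> and \<open>v\<close> whose letters are all distinct.\<close>

definition multishuffles :: "'a list \<Rightarrow> 'a list \<Rightarrow> 'a list set" where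
  "multishuffles u v = {w. set w \<subseteq> set u \<union> set v \<and> distinct_adj w \<and>
     is_multiword (filter (\<lambda>a. a \<in> set u) w) u \<and>
     is_multiword (filter (\<lambda>a. a \<in> set v) w) v}"

text \<open>
  The coefficient of \<open>w\<close> in the product of arbitrary words \<open>x\<close>, \<open>y\<close>. The generic letters
  \<open>u\<^sub>i\<close>, \<open>v\<^sub>j\<close> are \<open>Inl i\<close>, \<open>Inr j\<close>; the coefficient counts the multishuffles of the
  generic words that become \<open>w\<close> under \<open>u\<^sub>i \<mapsto> x\<^sub>i\<close>, \<open>v\<^sub>j \<mapsto> y\<^sub>j\<close>.
\<close>

definition word_star :: "'a list \<Rightarrow> 'a list \<Rightarrow> 'a list \<Rightarrow> int" where
  "word_star x y = (\<lambda>w. int (card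
     {s \<in> multishuffles (map Inl [0..<length x]) (map Inr [0..<length y]).
        map (case_sum (\<lambda>i. x ! i) (\<lambda>j. y ! j)) s = w}))"

text \<open>For \<open>w \<in> mperms n\<close> the shift \<open>card (set w)\<close> equals \<open>n\<close>.\<close>

definition word_mult :: "nat list \<Rightarrow> nat list \<Rightarrow> nat list \<Rightarrow> int" where
  "word_mult w u = word_star w (map (\<lambda>a. a + card (set w)) u)"

definition cuts :: "'a list \<Rightarrow> 'a list \<times> 'a list \<Rightarrow> int" where
  "cuts a = (\<lambda>p. (\<Sum>i = 0..length a. basis (take i a, drop i a) p) +
                 (\<Sum>i = 1..length a. basis (take i a, drop (i - 1) a) p))"

definition st :: "nat list \<Rightarrow> nat list" where
  "st w = (THE u. u \<in> all_mperms \<and> length u = length w \<and>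
     (\<forall>i < length w. \<forall>j < length w. w ! i \<le> w ! j \<longleftrightarrow> u ! i \<le> u ! j))"

definition word_comult :: "nat list \<Rightarrow> nat list \<times> nat list \<Rightarrow> int" where
  "word_comult w = extend (\<lambda>(x, y). basis (st x, st y)) (cuts w)"

definition mMR_mult :: "(nat list \<times> nat list \<Rightarrow> int) \<Rightarrow> (nat list \<Rightarrow> int)" where
  "mMR_mult = extend (\<lambda>(u, v). word_mult u v)"

definition mMR_unit :: "int \<Rightarrow> (nat list \<Rightarrow> int)" where
  "mMR_unit n = (\<lambda>w. n * basis [] w)"

definition mMR_comult :: "(nat list \<Rightarrow> int) \<Rightarrow> (nat list \<times> nat list \<Rightarrow> int)" where
  "mMR_comult = extend word_comult"

definition mMR_counit :: "(nat list \<Rightarrow> int) \<Rightarrow> int" where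
  "mMR_counit f = f []"

end

theory Submission imports Defs begin

text \<open>
  Both structure maps are transposes of explicit finite formulas. The coefficient of \<open>w\<close> in a
  product only involves the pairs (letters of \<open>w\<close> up to \<open>n\<close>, remaining letters lowered by
  \<open>n\<close>), with adjacent repetitions collapsed. Cutting a word, with or without duplicating the
  letter at the cut, amounts to choosing words \<open>x\<close>, \<open>y\<close> such that \<open>x @ y\<close> collapses to it; hence
  the coefficient of \<open>(p, q)\<close> in a coproduct involves the collapsed concatenations of all
  relabellings of \<open>p\<close> and \<open>q\<close> whose letters together form an initial interval. Such relabellings are
  given by pairs of sets \<open>(A, B)\<close> covering the interval, and the axioms become bijections
  between such pairs: coassociativity compares two ways of covering by three sets, and
  compatibility says that a cover of \<open>{1..N}\<close> with a threshold \<open>k\<close> is a cover of \<open>{1..k}\<close>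
  together with one of \<open>{1..N - k}\<close>.
\<close>

section \<open>Maps with finite coefficient sums\<close>

text \<open>A product of two nonempty words is an infinite sum (12, 121, 1212, ... all occur in the
  product of 1 with 1), so composing maps on basis elements would mean rearranging infinite
  families. Fixing a word of the target instead and asking which source coefficients reach it leaves
  finite sums throughout, and composites become iterated finite sums. The obstacle on the product
  side is that the definition counts multishuffles of generic words with distinct letters, while
  only the substituted word is visible in the target. As factors may repeat letters, one word could
  have several generic preimages. It has at most one: the alphabets of the two factors are disjoint,
  so each letter reveals its factor, and since neither factor has equal neighbours, the position
  inside the factor can be read off from the right end. This turns nested restrictions and gluings
  into a single collapse, and the summands then depend only on thresholds and letter sets.\<close>

definition coeff_sum ::
    "'a set \<Rightarrow> (('a \<Rightarrow> int) \<Rightarrow> ('b \<Rightarrow> int)) \<Rightarrow> ('b \<Rightarrow> 'i set) \<Rightarrow> ('b \<Rightarrow> 'i \<Rightarrow> 'a) \<Rightarrow> bool" where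
  "coeff_sum S F I \<phi> \<longleftrightarrow>
     (\<forall>b. finite (I b) \<and> (\<forall>f \<in> cfree S. F f b = (\<Sum>i\<in>I b. f (\<phi> b i))))"

lemma coeff_sumD:
  assumes "coeff_sum S F I \<phi>"
  shows "finite (I b)" and "f \<in> cfree S \<Longrightarrow> F f b = (\<Sum>i\<in>I b. f (\<phi> b i))"
  using assms by (auto simp: coeff_sum_def)

lemma basis_in_cfree: "a \<in> S \<Longrightarrow> basis a \<in> cfree S"
  by (auto simp: cfree_def basis_def)

lemma cfree_outside: "f \<in> cfree S \<Longrightarrow> a \<notin> S \<Longrightarrow> f a = 0"
  by (auto simp: cfree_def)

lemma basis_pair: "basis (a, b) (c, d) = basis a c * basis b d"
  by (auto simp: basis_def)

lemma support_basis_sum: "{a. c a * (\<Sum>i\<in>I. basis a (\<phi> i)) \<noteq> 0} \<subseteq> \<phi> ` I"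
proof
  fix a assume "a \<in> {a. c a * (\<Sum>i\<in>I. basis a (\<phi> i)) \<noteq> 0}"
  then have "(\<Sum>i\<in>I. basis a (\<phi> i)) \<noteq> 0" by simp
  then obtain i where "i \<in> I" "basis a (\<phi> i) \<noteq> 0"
    by (rule sum.not_neutral_contains_not_neutral)
  then show "a \<in> \<phi> ` I"
    by (auto simp: basis_def split: if_splits)
qed

text \<open>Values of \<open>\<phi>\<close> may coincide: the inner sum records the multiplicity.
  Hence thresholds and covers can serve as indices, and sums can be compared by reindexing
  them.\<close>

lemma Sum_any_basis_sum:
  assumes "finite I"
  shows "Sum_any (\<lambda>a. c a * (\<Sum>i\<in>I. basis a (\<phi> i))) = (\<Sum>i\<in>I. c (\<phi> i))"
proof -
  have "Sum_any (\<lambda>a. c a * (\<Sum>i\<in>I. basis a (\<phi> i))) =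
      (\<Sum>a\<in>\<phi> ` I. c a * (\<Sum>i\<in>I. basis a (\<phi> i)))"
    using assms by (intro Sum_any.expand_superset support_basis_sum) simp
  also have "\<dots> = (\<Sum>i\<in>I. \<Sum>a\<in>\<phi> ` I. c a * basis a (\<phi> i))"
    by (simp add: sum_distrib_left sum.swap[of _ "\<phi> ` I"])
  also have "\<dots> = (\<Sum>i\<in>I. c (\<phi> i))"
  proof (rule sum.cong[OF refl])
    fix i assume "i \<in> I"
    have "(\<Sum>a\<in>\<phi> ` I. c a * basis a (\<phi> i)) = (\<Sum>a\<in>\<phi> ` I. if \<phi> i = a then c a else 0)"
      by (rule sum.cong) (auto simp: basis_def)
    then show "(\<Sum>a\<in>\<phi> ` I. c a * basis a (\<phi> i)) = c (\<phi> i)"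
      using assms \<open>i \<in> I\<close> by simp
  qed
  finally show ?thesis .
qed

text \<open>Only the values of \<open>K\<close> on \<open>S\<close> matter, because \<open>f\<close>
  vanishes elsewhere. The kernels below, such as \<open>word_mult\<close>, are controlled only on
  m-permutations.\<close>

lemma coeff_sum_extend:
  assumes fin: "\<And>b. finite (I b)"
    and K: "\<And>a b. a \<in> S \<Longrightarrow> K a b = (\<Sum>i\<in>I b. basis a (\<phi> b i))"
  shows "coeff_sum S (extend K) I \<phi>"
  unfolding coeff_sum_def
proof (intro allI conjI ballI fin)
  fix b f assume f: "f \<in> cfree S"
  have "f a * K a b = f a * (\<Sum>i\<in>I b. basis a (\<phi> b i))" for a
    using K[of a b] cfree_outside[OF f, of a] by (cases "a \<in> S") auto
  then have "extend K f b = Sum_any (\<lambda>a. f a * (\<Sum>i\<in>I b. basis a (\<phi> b i)))"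
    by (simp only: extend_def)
  also have "\<dots> = (\<Sum>i\<in>I b. f (\<phi> b i))"
    by (rule Sum_any_basis_sum[OF fin])
  finally show "extend K f b = (\<Sum>i\<in>I b. f (\<phi> b i))" .
qed

lemma coeff_sum_id: "coeff_sum S id (\<lambda>_. {()}) (\<lambda>b _. b)"
  by (simp add: coeff_sum_def)

lemma coeff_sum_tensor_map:
  fixes F :: "('a \<Rightarrow> int) \<Rightarrow> 'b \<Rightarrow> int" and G :: "('c \<Rightarrow> int) \<Rightarrow> 'd \<Rightarrow> int"
  assumes F: "coeff_sum S F I \<phi>" and G: "coeff_sum T G J \<psi>"
  shows "coeff_sum (S \<times> T) (tensor_map F G)
           (\<lambda>(c, d). I c \<times> J d) (\<lambda>(c, d) (i, j). (\<phi> c i, \<psi> d j))"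
  unfolding tensor_map_def
proof (rule coeff_sum_extend)
  fix p and q :: "'b \<times> 'd" assume p: "p \<in> S \<times> T"
  obtain a b where [simp]: "p = (a, b)" by (cases p)
  obtain c d where [simp]: "q = (c, d)" by (cases q)
  have "F (basis a) c * G (basis b) d =
      (\<Sum>i\<in>I c. basis a (\<phi> c i)) * (\<Sum>j\<in>J d. basis b (\<psi> d j))"
    using p by (simp add: coeff_sumD(2)[OF F] coeff_sumD(2)[OF G] basis_in_cfree)
  then show "(case p of (a, b) \<Rightarrow> tensor (F (basis a)) (G (basis b))) q =
      (\<Sum>i\<in>(case q of (c, d) \<Rightarrow> I c \<times> J d).
         basis p ((case q of (c, d) \<Rightarrow> \<lambda>(i, j). (\<phi> c i, \<psi> d j)) i))"
    by (simp add: tensor_def sum_product sum.cartesian_product basis_pair case_prod_unfold)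
qed (auto simp: coeff_sumD(1)[OF F] coeff_sumD(1)[OF G])

text \<open>For fixed \<open>b\<close>, a basis element \<open>a\<close> contributes only if it is a
  value of \<open>\<phi> b\<close> on the finite set \<open>I b\<close>. This gives the finiteness
  as well as the sum formula.\<close>

lemma continuous_linear_coeff_sum:
  assumes F: "coeff_sum S F I \<phi>" and img: "\<And>f. f \<in> cfree S \<Longrightarrow> F f \<in> cfree T"
  shows "continuous_linear S T F"
  unfolding continuous_linear_def
proof (intro ballI conjI allI img)
  fix c b assume c: "c \<in> cfree S"
  note fin = coeff_sumD(1)[OF F, of b]
  have *: "c a * F (basis a) b = c a * (\<Sum>i\<in>I b. basis a (\<phi> b i))" for a
    using coeff_sumD(2)[OF F basis_in_cfree, of a b] cfree_outside[OF c, of a]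
    by (cases "a \<in> S") auto
  show "finite {a. c a * F (basis a) b \<noteq> 0}"
    unfolding * by (rule finite_subset[OF support_basis_sum]) (simp add: fin)
  show "F c b = Sum_any (\<lambda>a. c a * F (basis a) b)"
    unfolding * by (simp add: Sum_any_basis_sum[OF fin] coeff_sumD(2)[OF F c])
qed

lemma coeff_sum_in_cfree:
  assumes F: "coeff_sum S F I \<phi>" and "\<And>b. b \<notin> T \<Longrightarrow> I b = {}" and "f \<in> cfree S"
  shows "F f \<in> cfree T"
  using assms(2) coeff_sumD(2)[OF F assms(3)] by (fastforce simp: cfree_def)

section \<open>Collapsing repeated adjacent letters\<close>

text \<open>A new last letter either extends the collapsed word or is absorbed by an equal last
  letter. These are the two cases of every induction on shuffles from the right.\<close>

lemma remdups_adj_snoc_eq_snoc: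
  "remdups_adj (xs @ [z]) = ys @ [z'] \<longleftrightarrow>
     z' = z \<and> (remdups_adj xs = ys \<and> (ys = [] \<or> last ys \<noteq> z) \<or> remdups_adj xs = ys @ [z])"
proof (cases xs rule: rev_cases)
  case (snoc us u)
  have "last (remdups_adj (us @ [u])) = u"
    by simp
  then show ?thesis
    unfolding snoc by (auto simp: remdups_adj_append_two simp del: last_remdups_adj)
qed auto

text \<open>Serves to transport a collision of neighbours, \<open>f a = f b\<close>, from a shuffle
  to the collapsed restriction containing both letters.\<close>

lemma remdups_adj_adjacent_factor:
  assumes "a \<noteq> b"
  shows "\<exists>p' q'. remdups_adj (p @ a # b # q) = p' @ a # b # q'"
proof (intro exI)
  have "remdups_adj (p @ a # b # q) = remdups_adj (p @ [a]) @ tl (remdups_adj (a # b # q))"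
    by (rule remdups_adj_append)
  also have "tl (remdups_adj (a # b # q)) = b # tl (remdups_adj (b # q))"
    using assms by simp
  also have "remdups_adj (p @ [a]) = butlast (remdups_adj (p @ [a])) @ [a]"
    using append_butlast_last_id[of "remdups_adj (p @ [a])"] by simp
  finally show "remdups_adj (p @ a # b # q) =
      butlast (remdups_adj (p @ [a])) @ a # b # tl (remdups_adj (b # q))"
    by (simp only: append.simps append_assoc)
qed

lemma distinct_adj_iff_factor: "distinct_adj s \<longleftrightarrow> (\<forall>p a b q. s = p @ a # b # q \<longrightarrow> a \<noteq> b)"
proof
  assume "\<forall>p a b q. s = p @ a # b # q \<longrightarrow> a \<noteq> b"
  then show "distinct_adj s"
    unfolding distinct_adj_conv_nth
    by (metis Cons_nth_drop_Suc Suc_lessD id_take_nth_drop)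
qed (auto simp: distinct_adj_append_iff)

lemma remdups_adj_Cons_cong: "remdups_adj xs = remdups_adj ys \<Longrightarrow> remdups_adj (x # xs) = remdups_adj (x # ys)"
  by (simp only: remdups_adj_Cons)

text \<open>Equal neighbours are kept or dropped together and have equal images, so the outer
  collapse also does the work of the inner one.\<close>

lemma remdups_adj_map_filter:
  "remdups_adj (map f (filter P (remdups_adj xs))) = remdups_adj (map f (filter P xs))"
proof (induction xs rule: remdups_adj.induct)
  case (3 x y xs)
  show ?case
  proof (cases "x = y")
    case True
    then show ?thesis using 3(1) by (cases "P y") simp_all
  next
    case False
    note IH = 3(2)[OF False]
    have "remdups_adj (f x # map f (filter P (remdups_adj (y # xs)))) =
        remdups_adj (f x # map f (filter P (y # xs)))"
      by (rule remdups_adj_Cons_cong) (rule IH)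
    with IH False show ?thesis by (cases "P x") simp_all
  qed
qed simp_all

lemmas remdups_adj_filter = remdups_adj_map_filter[where f = id, simplified]
lemmas remdups_adj_map = remdups_adj_map_filter[where P = "\<lambda>_. True", simplified]

lemma remdups_adj_append_remdups_adj_right:
  "remdups_adj (xs @ remdups_adj ys) = remdups_adj (xs @ ys)"
proof (induction xs)
  case (Cons x xs)
  then show ?case by (simp only: append.simps) (rule remdups_adj_Cons_cong)
qed (simp flip: distinct_adj_altdef)

lemma remdups_adj_append_remdups_adj_left:
  "remdups_adj (remdups_adj xs @ ys) = remdups_adj (xs @ ys)"
  using remdups_adj_append_remdups_adj_right[of "rev ys" "rev xs"]
  by (metis remdups_adj_rev rev_append rev_rev_ident)

section \<open>Multishuffles as lifts of words\<close>

text \<open>Collapsing is characterised by a monotone index map that stays constant exactly where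
  the word repeats a letter. For a multiword only constancy of the index is known to imply equality
  of letters; distinctness of \<open>u\<close> supplies the converse.\<close>

lemma is_multiword_iff:
  assumes u: "distinct u"
  shows "is_multiword w u \<longleftrightarrow> remdups_adj w = u"
proof
  assume "remdups_adj w = u"
  then show "is_multiword w u"
    unfolding remdups_adj_altdef is_multiword_def lessThan_atLeast0
    by (auto intro: monotone_on_subset)
next
  assume "is_multiword w u"
  then obtain t where mono: "mono_on {..<length w} t" and
    img: "t ` {..<length w} = {..<length u}" and
    nth: "\<And>j. j < length w \<Longrightarrow> w ! j = u ! t j"
    unfolding is_multiword_def by auto
  \<comment> \<open>\<open>t\<close> is monotone on the positions of \<open>w\<close> only, while
    \<open>mono\<close> speaks of all numbers, so \<open>t\<close> is continued constantly after the
    last position.\<close>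
  define f where "f i = t (min i (length w - 1))" for i
  have f: "f i = t i" if "i < length w" for i
    using that by (auto simp: f_def min_def intro: arg_cong[of _ _ t])
  show "remdups_adj w = u"
  proof (cases "w = []")
    case True
    with img show ?thesis by auto
  next
    case False
    then obtain n where len: "length w = Suc n"
      by (cases w) auto
    show ?thesis
      unfolding remdups_adj_altdef
    proof (intro exI[of _ f] conjI allI impI)
      show "mono f"
        unfolding f_def using mono
        by (intro monoI mono_onD[of "{..<length w}" t]) (auto simp: len)
      show "f ` {0..<length w} = {0..<length u}"
        using img by (auto simp: f lessThan_atLeast0 cong: image_cong_simp)
      show "w ! i = u ! f i" if "i < length w" for i
        using that nth f by simp
      have *: "t i < length u" if "i < length w" for i
        using that img by auto
      show "(w ! i = w ! (i + 1)) = (f i = f (i + 1))" if "i + 1 < length w" for i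
        using that u *[of i] *[of "i + 1"] by (simp add: nth f nth_eq_iff_index_eq)
    qed
  qed
qed

text \<open>The predicate \<open>P\<close> tells which factor a letter comes from. It is
  \<open>isl\<close> for generic words and membership in the first factor for substituted words.
  Negating it exchanges the factors, so each argument is needed for one side only.\<close>

definition shuffle_word :: "('a \<Rightarrow> bool) \<Rightarrow> 'a list \<Rightarrow> 'a list \<Rightarrow> 'a list \<Rightarrow> bool" where
  "shuffle_word P U V s \<longleftrightarrow> distinct_adj s \<and>
     remdups_adj (filter P s) = U \<and> remdups_adj (filter (\<lambda>a. \<not> P a) s) = V"

lemma shuffle_word_swap: "shuffle_word P U V s \<longleftrightarrow> shuffle_word (\<lambda>a. \<not> P a) V U s"
  by (auto simp: shuffle_word_def)

lemma shuffle_word_letters: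
  assumes "shuffle_word P U V s"
  shows "set s = set U \<union> set V"
proof -
  have "set U = {a\<in>set s. P a}" "set V = {a\<in>set s. \<not> P a}"
    using assms by (auto simp: shuffle_word_def)
  then show ?thesis by auto
qed

lemma shuffle_word_snoc:
  assumes "P z"
  shows "shuffle_word P U V (s @ [z]) \<longleftrightarrow> U \<noteq> [] \<and> last U = z \<and> (s = [] \<or> last s \<noteq> z) \<and>
     (shuffle_word P U V s \<or>
      shuffle_word P (butlast U) V s \<and> (butlast U = [] \<or> last (butlast U) \<noteq> z))"
  using assms
  by (cases U rule: rev_cases)
     (auto simp: shuffle_word_def remdups_adj_snoc_eq_snoc distinct_adj_append_iff)

text \<open>Substitution creates no equal neighbours. Letters of different factors are separated by
  \<open>Q\<close>; unequal neighbours from the same factor stay neighbours in its collapsed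
  restriction, that is in \<open>U\<close> or \<open>V\<close>, whose images have no equal
  neighbours.\<close>

lemma shuffle_word_map:
  assumes s: "shuffle_word P U V s" and PQ: "\<And>a. a \<in> set s \<Longrightarrow> Q (f a) = P a"
    and U: "distinct_adj (map f U)" and V: "distinct_adj (map f V)"
  shows "shuffle_word Q (map f U) (map f V) (map f s)"
proof -
  have "remdups_adj (filter Q (map f s)) = remdups_adj (map f (filter P s))"
    using PQ by (auto simp: filter_map intro!: arg_cong[of _ _ remdups_adj] cong: filter_cong)
  also have "\<dots> = remdups_adj (map f U)"
    using s remdups_adj_map[of f "filter P s"] by (simp add: shuffle_word_def)
  also have "\<dots> = map f U"
    using U by (simp add: distinct_adj_altdef)
  finally have 1: "remdups_adj (filter Q (map f s)) = map f U" .
  have "remdups_adj (filter (\<lambda>a. \<not> Q a) (map f s)) = remdups_adj (map f (filter (\<lambda>a. \<not> P a) s))"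
    using PQ by (auto simp: filter_map intro!: arg_cong[of _ _ remdups_adj] cong: filter_cong)
  also have "\<dots> = remdups_adj (map f V)"
    using s remdups_adj_map[of f "filter (\<lambda>a. \<not> P a) s"] by (simp add: shuffle_word_def)
  also have "\<dots> = map f V"
    using V by (simp add: distinct_adj_altdef)
  finally have 2: "remdups_adj (filter (\<lambda>a. \<not> Q a) (map f s)) = map f V" .
  have "f a \<noteq> f b" if dec: "s = p @ a # b # q" for p a b q
  proof
    assume eq: "f a = f b"
    have "a \<noteq> b"
      using s dec by (auto simp: shuffle_word_def distinct_adj_iff_factor)
    have P: "P a = P b"
      using PQ[of a] PQ[of b] eq dec by auto
    have bad: "\<not> distinct_adj (map f (remdups_adj (filter R s)))" if "R a" "R b" for R
    proof -
      obtain p' q' where "remdups_adj (filter R p @ a # b # filter R q) = p' @ a # b # q'"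
        using remdups_adj_adjacent_factor[OF \<open>a \<noteq> b\<close>] by blast
      then show ?thesis
        using that dec eq by (auto simp: distinct_adj_append_iff)
    qed
    show False
      using bad[of P] bad[of "\<lambda>a. \<not> P a"] P U V s by (auto simp: shuffle_word_def)
  qed
  then have "distinct_adj (map f s)"
    unfolding distinct_adj_iff_factor by (auto simp: map_eq_append_conv map_eq_Cons_conv)
  with 1 2 show ?thesis
    by (simp add: shuffle_word_def)
qed

text \<open>The image of the last letter reveals its factor through \<open>Q\<close>, and the letter
  itself is then the last one of that factor. After its removal the factor is either unchanged or
  one letter shorter, and the image decides which.\<close>

lemma shuffle_word_lift_unique:
  assumes "shuffle_word P U V s" "shuffle_word P U V s'" "map f s = map f s'"
    and PQ: "\<And>a. a \<in> set U \<union> set V \<Longrightarrow> Q (f a) = P a"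
    and "distinct_adj (map f U)" "distinct_adj (map f V)"
  shows "s = s'"
  using assms
proof (induction s arbitrary: s' U V rule: rev_induct)
  case (snoc z s)
  obtain r z' where s': "s' = r @ [z']" and fz: "f z = f z'" and fs: "map f s = map f r"
    using snoc.prems(3) by (cases s' rule: rev_cases) auto
  \<comment> \<open>Stated for an arbitrary side \<open>X\<close>: if \<open>P z\<close> fails, it
    is applied with \<open>P\<close> and \<open>Q\<close> negated and with \<open>U\<close> and
    \<open>V\<close> exchanged.\<close>
  have *: "s @ [z] = s'"
    if M: "shuffle_word R X Y (s @ [z])" "shuffle_word R X Y s'" and R: "R z"
      and RQ: "\<And>a. a \<in> set X \<union> set Y \<Longrightarrow> Q' (f a) = R a"
      and d: "distinct_adj (map f X)" "distinct_adj (map f Y)"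
      and IH: "\<And>X' r. shuffle_word R X' Y s \<Longrightarrow> shuffle_word R X' Y r \<Longrightarrow> map f s = map f r \<Longrightarrow>
         set X' \<subseteq> set X \<Longrightarrow> distinct_adj (map f X') \<Longrightarrow> s = r"
    for R X Y Q'
  proof -
    have "z \<in> set X \<union> set Y" "z' \<in> set X \<union> set Y"
      using shuffle_word_letters[OF M(1)] shuffle_word_letters[OF M(2)] s' by auto
    then have "R z'"
      using RQ fz R by metis
    then have eq: "z = z'"
      using M R by (simp add: s' shuffle_word_snoc)
    obtain X1 where X1: "shuffle_word R X1 Y s" "X1 = X \<or> X1 = butlast X"
      using M(1) R by (auto simp: shuffle_word_snoc)
    obtain X2 where X2: "shuffle_word R X2 Y r" "X2 = X \<or> X2 = butlast X"
      using M(2) \<open>R z'\<close> by (auto simp: s' shuffle_word_snoc)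
    have sub: "set X1 \<subseteq> set X" "set X2 \<subseteq> set X"
      using X1(2) X2(2) by (auto dest: in_set_butlastD)
    have d12: "distinct_adj (map f X1)" "distinct_adj (map f X2)"
      using X1(2) X2(2) d(1)
      by (metis append_butlast_last_id butlast.simps(1) distinct_adj_appendD1 map_append)+
    have W1: "shuffle_word Q' (map f X1) (map f Y) (map f s)"
      by (rule shuffle_word_map[OF X1(1) _ d12(1) d(2)])
         (use RQ sub shuffle_word_letters[OF X1(1)] in auto)
    have W2: "shuffle_word Q' (map f X2) (map f Y) (map f r)"
      by (rule shuffle_word_map[OF X2(1) _ d12(2) d(2)])
         (use RQ sub shuffle_word_letters[OF X2(1)] in auto)
    \<comment> \<open>Both are the collapsed restriction of the same word \<open>map f s\<close>.
      Their common length then separates \<open>X\<close> from \<open>butlast X\<close>.\<close>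
    have "map f X1 = map f X2"
      using W1 W2 fs by (simp add: shuffle_word_def)
    then have "length X1 = length X2"
      by (rule map_eq_imp_length_eq)
    moreover have "X \<noteq> []"
      using M(1) R by (simp add: shuffle_word_snoc)
    then have "length (butlast X) \<noteq> length X"
      by (cases X) auto
    ultimately have "X1 = X2"
      using X1(2) X2(2) by auto
    then have "s = r"
      using IH[OF X1(1)] X2(1) fs sub d12 by blast
    then show ?thesis
      using eq s' by simp
  qed
  show ?case
  proof (cases "P z")
    case True
    show ?thesis
    proof (rule *[OF snoc.prems(1,2) True snoc.prems(4,5,6)])
      fix X' r
      assume "shuffle_word P X' V s" "shuffle_word P X' V r" "map f s = map f r"
        "set X' \<subseteq> set U" "distinct_adj (map f X')"
      then show "s = r"
        using snoc.prems(4,6) by (intro snoc.IH[of X' V r]) auto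
    qed
  next
    case False
    show ?thesis
    proof (rule *[of "\<lambda>a. \<not> P a" V U "\<lambda>a. \<not> Q a"])
      fix X' r
      assume "shuffle_word (\<lambda>a. \<not> P a) X' U s" "shuffle_word (\<lambda>a. \<not> P a) X' U r"
        "map f s = map f r" "set X' \<subseteq> set V" "distinct_adj (map f X')"
      then show "s = r"
        using snoc.prems(4,5)
        by (intro snoc.IH[of U X' r]) (auto simp: shuffle_word_swap[of P])
    qed (use False snoc.prems shuffle_word_swap[of P] in auto)
  qed
qed simp

text \<open>The lift is built from the right. A last letter \<open>c\<close> on the side of
  \<open>X\<close> is lifted to \<open>last X\<close>, and whether \<open>X\<close> then loses this
  letter is decided by the image word.\<close>

lemma shuffle_word_lift_exists:
  assumes "shuffle_word Q (map f U) (map f V) w"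
    and "\<And>a. a \<in> set U \<Longrightarrow> P a" "\<And>a. a \<in> set V \<Longrightarrow> \<not> P a"
  shows "\<exists>s. shuffle_word P U V s \<and> map f s = w"
  using assms
proof (induction w arbitrary: U V rule: rev_induct)
  case Nil
  then show ?case by (auto simp: shuffle_word_def)
next
  case (snoc c w)
  have *: "\<exists>s. shuffle_word R X Y s \<and> map f s = w @ [c]"
    if W: "shuffle_word Q' (map f X) (map f Y) (w @ [c])" and c: "Q' c"
      and X: "\<And>a. a \<in> set X \<Longrightarrow> R a"
      and IH: "\<And>X'. shuffle_word Q' (map f X') (map f Y) w \<Longrightarrow> set X' \<subseteq> set X \<Longrightarrow>
         \<exists>s. shuffle_word R X' Y s \<and> map f s = w"
    for R X Y Q'
  proof -
    have W': "X \<noteq> []" "f (last X) = c" "w = [] \<or> last w \<noteq> c"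
      "shuffle_word Q' (map f X) (map f Y) w \<or>
       shuffle_word Q' (map f (butlast X)) (map f Y) w \<and>
         (butlast X = [] \<or> f (last (butlast X)) \<noteq> c)"
      using W c by (auto simp: shuffle_word_snoc last_map map_butlast[symmetric])
    have "R (last X)" using X W'(1) by simp
    have "\<exists>s. map f s = w \<and> (shuffle_word R X Y s \<or> shuffle_word R (butlast X) Y s \<and>
        (butlast X = [] \<or> f (last (butlast X)) \<noteq> c))"
      using W'(4) IH[of X] IH[of "butlast X"] by (auto dest: in_set_butlastD)
    then obtain s where s: "map f s = w" "shuffle_word R X Y s \<or> shuffle_word R (butlast X) Y s \<and>
        (butlast X = [] \<or> f (last (butlast X)) \<noteq> c)"
      by blast
    \<comment> \<open>The last letter of \<open>s\<close> lies over the last letter of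
      \<open>w\<close>, which differs from \<open>c\<close>, whereas \<open>last X\<close> lies over
      \<open>c\<close>.\<close>
    have "s = [] \<or> last s \<noteq> last X"
      using W'(2,3) s(1) by (auto simp: last_map)
    then have "shuffle_word R X Y (s @ [last X])"
      using W' s(2) \<open>R (last X)\<close> by (auto simp: shuffle_word_snoc)
    then show ?thesis
      using s(1) W'(2) by (intro exI[of _ "s @ [last X]"]) simp
  qed
  show ?case
  proof (cases "Q c")
    case True
    show ?thesis
    proof (rule *[OF snoc.prems(1) True snoc.prems(2)])
      fix X' assume "shuffle_word Q (map f X') (map f V) w" "set X' \<subseteq> set U"
      then show "\<exists>s. shuffle_word P X' V s \<and> map f s = w"
        using snoc.prems by (intro snoc.IH) auto
    qed
  next
    case False
    have "\<exists>s. shuffle_word (\<lambda>a. \<not> P a) V U s \<and> map f s = w @ [c]"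
    proof (rule *[of "\<lambda>a. \<not> Q a"])
      fix X' assume "shuffle_word (\<lambda>a. \<not> Q a) (map f X') (map f U) w" "set X' \<subseteq> set V"
      then show "\<exists>s. shuffle_word (\<lambda>a. \<not> P a) X' U s \<and> map f s = w"
        using snoc.prems snoc.IH[of U X'] by (auto simp: shuffle_word_swap[of P] shuffle_word_swap[of Q])
    qed (use False snoc.prems shuffle_word_swap[of Q] in auto)
    then show ?thesis
      by (simp add: shuffle_word_swap[of P])
  qed
qed

lemma multishuffles_iff:
  assumes "distinct U" "distinct V" "\<And>a. a \<in> set U \<Longrightarrow> P a" "\<And>a. a \<in> set V \<Longrightarrow> \<not> P a"
  shows "s \<in> multishuffles U V \<longleftrightarrow> shuffle_word P U V s"
proof -
  have F: "filter (\<lambda>a. a \<in> set U) s = filter P s \<and> filter (\<lambda>a. a \<in> set V) s = filter (\<lambda>a. \<not> P a) s"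
    if "set s \<subseteq> set U \<union> set V"
    using that assms(3,4) by (intro conjI filter_cong) auto
  have sub: "set s \<subseteq> set U \<union> set V" if "shuffle_word P U V s"
    using shuffle_word_letters[OF that] by simp
  show ?thesis
    unfolding multishuffles_def mem_Collect_eq is_multiword_iff[OF assms(1)] is_multiword_iff[OF assms(2)]
    using F sub unfolding shuffle_word_def by metis
qed

text \<open>All coefficients are 0 or 1. Disjointness of the letters makes membership in
  \<open>set x\<close> agree with \<open>isl\<close> on the generic letters, so lifts exist and are
  unique.\<close>

lemma word_star_eq:
  assumes x: "distinct_adj x" and y: "distinct_adj y" and disj: "set x \<inter> set y = {}"
  shows "word_star x y w = (if shuffle_word (\<lambda>a. a \<in> set x) x y w then 1 else 0)"
proof -
  let ?f = "case_sum (\<lambda>i. x ! i) (\<lambda>j. y ! j)"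
  let ?U = "map Inl [0..<length x] :: (nat + nat) list"
  let ?V = "map Inr [0..<length y] :: (nat + nat) list"
  let ?A = "{s \<in> multishuffles ?U ?V. map ?f s = w}"
  have fU: "map ?f ?U = x" and fV: "map ?f ?V = y"
    by (simp_all add: comp_def map_nth)
  have ms: "s \<in> multishuffles ?U ?V \<longleftrightarrow> shuffle_word isl ?U ?V s" for s
    by (rule multishuffles_iff) (auto simp: distinct_map)
  have PQ: "(?f a \<in> set x) = isl a" if "a \<in> set ?U \<union> set ?V" for a
    using that disj by (auto simp: disjoint_iff)
  show ?thesis
  proof (cases "shuffle_word (\<lambda>a. a \<in> set x) x y w")
    case True
    have "\<exists>s. shuffle_word isl ?U ?V s \<and> map ?f s = w"
      by (rule shuffle_word_lift_exists[where Q = "\<lambda>a. a \<in> set x"])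
         (unfold fU fV, use True in auto)
    then obtain s where s: "shuffle_word isl ?U ?V s" "map ?f s = w" by blast
    have "s' = s" if s': "shuffle_word isl ?U ?V s'" "map ?f s' = w" for s'
    proof (rule shuffle_word_lift_unique[OF s'(1) s(1)])
      show "map ?f s' = map ?f s" by (simp only: s'(2) s(2))
      show "(?f a \<in> set x) = isl a" if "a \<in> set ?U \<union> set ?V" for a
        using that by (rule PQ)
    qed (simp_all only: fU fV x y)
    then have "?A = {s}"
      using s unfolding ms by blast
    then show ?thesis
      using True by (simp add: word_star_def)
  next
    case False
    have "?A = {}"
    proof (rule ccontr)
      assume "?A \<noteq> {}"
      then obtain s where s: "shuffle_word isl ?U ?V s" "map ?f s = w"
        unfolding ms by blast
      have "shuffle_word (\<lambda>a. a \<in> set x) (map ?f ?U) (map ?f ?V) (map ?f s)"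
        by (rule shuffle_word_map[OF s(1)])
           (simp_all only: fU fV x y PQ shuffle_word_letters[OF s(1)])
      then show False
        unfolding fU fV using False s by simp
    qed
    then show ?thesis
      using False by (simp only: word_star_def card.empty of_nat_0 if_False)
  qed
qed

section \<open>The product\<close>

text \<open>\<open>low n w\<close> and \<open>high n w\<close> are the only factors, the first one
  on \<open>n\<close> letters, whose product can contain \<open>w\<close>.\<close>

definition low :: "nat \<Rightarrow> nat list \<Rightarrow> nat list" where
  "low n w = remdups_adj (filter (\<lambda>a. a \<le> n) w)"

definition high :: "nat \<Rightarrow> nat list \<Rightarrow> nat list" where
  "high n w = remdups_adj (map (\<lambda>a. a - n) (filter (\<lambda>a. n < a) w))"

lemma mpermsD:
  assumes "w \<in> mperms n"
  shows "set w = {1..n}" "distinct_adj w" "card (set w) = n"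
  using assms by (auto simp: mperms_def)

lemma all_mperms_iff: "w \<in> all_mperms \<longleftrightarrow> w \<in> mperms (card (set w))"
  unfolding all_mperms_def UN_iff using mpermsD(3) by blast

lemma mperms_all_mperms: "w \<in> mperms n \<Longrightarrow> w \<in> all_mperms"
  by (auto simp: all_mperms_def)

lemma low_mperms: "w \<in> mperms N \<Longrightarrow> n \<le> N \<Longrightarrow> low n w \<in> mperms n"
  by (auto simp: low_def mperms_def)

lemma high_mperms:
  assumes "w \<in> mperms N" "n \<le> N"
  shows "high n w \<in> mperms (N - n)"
proof -
  have "(\<lambda>a. a - n) ` {a \<in> {1..N}. n < a} = {1..N - n}"
  proof
    show "{1..N - n} \<subseteq> (\<lambda>a. a - n) ` {a \<in> {1..N}. n < a}"
    proof
      fix x assume "x \<in> {1..N - n}"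
      then show "x \<in> (\<lambda>a. a - n) ` {a \<in> {1..N}. n < a}"
        by (intro rev_image_eqI[of "x + n"]) auto
    qed
  qed auto
  then show ?thesis
    using mpermsD(1)[OF assms(1)] by (simp add: high_def mperms_def)
qed

text \<open>Either side forces the letters of \<open>w\<close> to be \<open>{1..n + m}\<close>. On
  such words, lying in \<open>set u\<close> means being at most \<open>n\<close>, and the collapsed
  large letters can be compared with \<open>v\<close> because the shift is injective.\<close>

lemma shuffle_word_iff_low_high:
  assumes u: "u \<in> mperms n" and v: "v \<in> mperms m"
  shows "shuffle_word (\<lambda>a. a \<in> set u) u (map (\<lambda>a. a + n) v) w \<longleftrightarrow>
     w \<in> mperms (n + m) \<and> low n w = u \<and> high n w = v"
    (is "?L \<longleftrightarrow> ?R")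
proof -
  have shifted: "(\<lambda>a. a + n) ` {1..m} = {n + 1..n + m}"
    by (simp add: add.commute[of _ n] del: add_Suc_right)
  have letters: "set w = {1..n + m}" if ?L
    using shuffle_word_letters[OF that] mpermsD(1)[OF u] mpermsD(1)[OF v] shifted by auto
  have "?L \<longleftrightarrow> ?R" if w: "set w = {1..n + m}"
  proof -
    have small: "filter (\<lambda>a. a \<in> set u) w = filter (\<lambda>a. a \<le> n) w"
      using w mpermsD(1)[OF u] by (intro filter_cong) auto
    have large: "filter (\<lambda>a. a \<notin> set u) w = filter (\<lambda>a. n < a) w"
      using w mpermsD(1)[OF u] by (intro filter_cong) auto
    have "filter (\<lambda>a. n < a) w = map (\<lambda>a. a + n) (map (\<lambda>a. a - n) (filter (\<lambda>a. n < a) w))"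
      unfolding map_map by (rule map_idI[symmetric]) auto
    then have "remdups_adj (filter (\<lambda>a. n < a) w) =
        remdups_adj (map (\<lambda>a. a + n) (map (\<lambda>a. a - n) (filter (\<lambda>a. n < a) w)))"
      by (rule arg_cong)
    also have "\<dots> = map (\<lambda>a. a + n) (high n w)"
      unfolding high_def by (rule remdups_adj_map_injective) (simp add: inj_def)
    finally have "remdups_adj (filter (\<lambda>a. n < a) w) = map (\<lambda>a. a + n) v \<longleftrightarrow> high n w = v"
      by (simp add: inj_map_eq_map inj_def)
    then show ?thesis
      using w unfolding shuffle_word_def small large mperms_def low_def by auto
  qed
  then show ?thesis
    using letters mpermsD(1) by blast
qed

lemma word_mult_eq:
  assumes u: "u \<in> mperms n" and v: "v \<in> mperms m"
  shows "word_mult u v w = (if w \<in> mperms (n + m) \<and> low n w = u \<and> high n w = v then 1 else 0)"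
proof -
  have "word_star u (map (\<lambda>a. a + n) v) w =
      (if shuffle_word (\<lambda>a. a \<in> set u) u (map (\<lambda>a. a + n) v) w then 1 else 0)"
    using mpermsD[OF u] mpermsD[OF v] by (intro word_star_eq distinct_adj_mapI) auto
  then show ?thesis
    unfolding word_mult_def mpermsD(3)[OF u] shuffle_word_iff_low_high[OF u v] .
qed

text \<open>These are the possible thresholds. Both ends occur, for an empty first or second factor;
  for words that are not m-permutations the empty set makes the coefficient vanish.\<close>

definition mult_index :: "nat list \<Rightarrow> nat set" where
  "mult_index w = (if w \<in> all_mperms then {0..card (set w)} else {})"

text \<open>The letters of \<open>low k w\<close> are exactly \<open>{1..k}\<close>, so at most one
  threshold contributes: the number of letters of \<open>u\<close>.\<close>

lemma word_mult_basis_sum: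
  assumes u: "u \<in> all_mperms" and v: "v \<in> all_mperms"
  shows "word_mult u v w = (\<Sum>n\<in>mult_index w. basis (u, v) (low n w, high n w))"
proof (cases "w \<in> all_mperms")
  case True
  obtain n m N where n: "u \<in> mperms n" and m: "v \<in> mperms m" and N: "w \<in> mperms N"
    using u v True by (auto simp: all_mperms_def)
  have "basis (u, v) (low k w, high k w) =
      (if k = n then (if N = n + m \<and> low n w = u \<and> high n w = v then 1 else 0) else 0)"
    if k: "k \<le> N" for k
  proof (cases "low k w = u \<and> high k w = v")
    case True
    have "k = n"
      using mpermsD(3)[OF low_mperms[OF N k]] mpermsD(3)[OF n] True by simp
    moreover have "N - k = m"
      using mpermsD(3)[OF high_mperms[OF N k]] mpermsD(3)[OF m] True by simp
    ultimately show ?thesis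
      using True k by (simp add: basis_def)
  next
    case False
    then show ?thesis by (auto simp: basis_def)
  qed
  then have "(\<Sum>k\<in>{0..N}. basis (u, v) (low k w, high k w)) =
      (\<Sum>k\<in>{0..N}. if k = n then (if N = n + m \<and> low n w = u \<and> high n w = v then 1 else 0) else 0)"
    by (intro sum.cong) auto
  also have "\<dots> = (if N = n + m \<and> low n w = u \<and> high n w = v then 1 else 0)"
    by (simp add: sum.delta)
  also have "\<dots> = word_mult u v w"
  proof -
    have "w \<in> mperms (n + m) \<longleftrightarrow> N = n + m"
      using N mpermsD(3)[OF N] mpermsD(3)[of w "n + m"] by blast
    then show ?thesis
      by (simp only: word_mult_eq[OF n m])
  qed
  finally show ?thesis
    using True mpermsD(3)[OF N] by (simp add: mult_index_def)
next
  case False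
  then show ?thesis
    using u v by (auto simp: mult_index_def all_mperms_def word_mult_eq)
qed

lemma coeff_sum_mult:
  "coeff_sum (all_mperms \<times> all_mperms) mMR_mult mult_index (\<lambda>w n. (low n w, high n w))"
  unfolding mMR_mult_def
  by (rule coeff_sum_extend) (auto simp: word_mult_basis_sum, simp add: mult_index_def)

lemma low_low: "m \<le> n \<Longrightarrow> low m (low n w) = low m w"
  by (auto simp: low_def remdups_adj_filter intro!: arg_cong[of _ _ remdups_adj] filter_cong)

lemma high_low: "high m (low n w) = low (n - m) (high m w)"
proof -
  have "high m (low n w) = remdups_adj (map (\<lambda>a. a - m) (filter (\<lambda>a. m < a \<and> a \<le> n) w))"
    by (simp add: low_def high_def remdups_adj_map_filter conj_commute)
  \<comment> \<open>For \<open>n \<le> m\<close> truncated subtraction does no harm: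
    \<open>n - m\<close> is 0 while \<open>a - m\<close> is positive, so both conditions
    fail.\<close>
  also have "filter (\<lambda>a. m < a \<and> a \<le> n) w = filter (\<lambda>a. m < a \<and> a - m \<le> n - m) w"
    by (rule filter_cong) auto
  also have "remdups_adj (map (\<lambda>a. a - m) \<dots>) = low (n - m) (high m w)"
    by (simp add: low_def high_def remdups_adj_filter filter_map comp_def conj_commute)
  finally show ?thesis .
qed

lemma high_high: "high k (high m w) = high (m + k) w"
proof -
  have "high k (high m w) =
      remdups_adj (map (\<lambda>a. a - m - k) (filter (\<lambda>a. m < a \<and> k < a - m) w))"
    by (simp add: high_def remdups_adj_map_filter filter_map comp_def conj_commute)
  also have "filter (\<lambda>a. m < a \<and> k < a - m) w = filter (\<lambda>a. m + k < a) w"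
    by (rule filter_cong) auto
  finally show ?thesis
    by (simp add: high_def)
qed

section \<open>The coproduct\<close>

text \<open>For \<open>1 \<le> i \<le> card A\<close> this is the \<open>i\<close>-th smallest element of \<open>A\<close>, and junk otherwise.\<close>

definition enum :: "nat set \<Rightarrow> nat \<Rightarrow> nat" where
  "enum A i = sorted_list_of_set A ! (i - 1)"

lemma enum_strict_mono:
  assumes "finite A"
  shows "strict_mono_on {1..card A} (enum A)"
proof (rule strict_mono_onI)
  fix i j assume "i \<in> {1..card A}" "j \<in> {1..card A}" "i < j"
  then show "enum A i < enum A j"
    using assms unfolding enum_def
    by (intro sorted_wrt_nth_less[OF strict_sorted_list_of_set]) auto
qed

lemma enum_image:
  assumes "finite A"
  shows "enum A ` {1..card A} = A"
proof -
  have "enum A ` {1..card A} = (!) (sorted_list_of_set A) ` (\<lambda>i. i - 1) ` {1..card A}"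
    by (simp add: enum_def image_image)
  also have "(\<lambda>i. i - 1) ` {1..card A} = {0..<card A}"
  proof
    show "{0..<card A} \<subseteq> (\<lambda>i. i - 1) ` {1..card A}"
    proof
      fix i assume "i \<in> {0..<card A}"
      then show "i \<in> (\<lambda>i. i - 1) ` {1..card A}"
        by (intro rev_image_eqI[of "Suc i"]) auto
    qed
  qed auto
  also have "(!) (sorted_list_of_set A) ` {0..<card A} = set (sorted_list_of_set A)"
    by (simp add: nth_image)
  finally show ?thesis using assms by simp
qed

text \<open>This is how enumerations are computed below: an increasing parametrisation of a set is
  exhibited, and it must be the enumeration.\<close>

lemma enum_strict_mono_image:
  fixes f :: "nat \<Rightarrow> nat"
  assumes f: "strict_mono_on {1..n} f" and i: "i \<in> {1..n}"
  shows "enum (f ` {1..n}) i = f i"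
proof -
  have set: "set [1..<Suc n] = {1..n}"
    by (simp only: set_upt atLeastLessThanSuc_atLeastAtMost)
  have "sorted_wrt (<) (map f [1..<Suc n])"
    unfolding sorted_wrt_map
    by (rule sorted_wrt_mono_rel[OF _ sorted_wrt_upt]) (simp only: set strict_mono_onD[OF f])
  then have "sorted_list_of_set (set (map f [1..<Suc n])) = map f [1..<Suc n]"
    by (simp only: sorted_list_of_set.idem_if_sorted_distinct strict_sorted_iff)
  then have "sorted_list_of_set (f ` {1..n}) = map f [1..<Suc n]"
    by (simp only: set_map set)
  moreover have "map f [1..<Suc n] ! (i - 1) = f ([1..<Suc n] ! (i - 1))"
    using i by (intro nth_map) auto
  moreover have "[1..<Suc n] ! (i - 1) = i"
    using i nth_upt[of 1 "i - 1" "Suc n"] by auto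
  ultimately show ?thesis
    by (simp only: enum_def)
qed

section \<open>Standardization as the inverse of relabelling by an increasing enumeration\<close>

lemma map_enum_mperms:
  assumes "p \<in> mperms (card A)" "finite A"
  shows "set (map (enum A) p) = A" "distinct_adj (map (enum A) p)"
  using assms mpermsD[OF assms(1)] enum_image[OF assms(2)]
    strict_mono_on_imp_inj_on[OF enum_strict_mono[OF assms(2)]]
  by (auto simp: distinct_adj_map_iff)

text \<open>Two words with the same order pattern differ by a strictly increasing relabelling, and
  if one of them uses the letters \<open>{1..n}\<close>, that relabelling enumerates the letters of
  the other. So a word is determined by its standardization together with its set of
  letters.\<close>

lemma st_eq_iff:
  assumes x: "distinct_adj x"
  shows "st x = p \<longleftrightarrow> p \<in> mperms (card (set x)) \<and> x = map (enum (set x)) p"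
proof -
  let ?std = "\<lambda>u. u \<in> mperms (card (set x)) \<and> x = map (enum (set x)) u"
  note mono = enum_strict_mono[OF finite_set[of x]]
  note inj = strict_mono_on_imp_inj_on[OF mono]
  have iff: "u \<in> all_mperms \<and> length u = length x \<and>
      (\<forall>i < length x. \<forall>j < length x. x ! i \<le> x ! j \<longleftrightarrow> u ! i \<le> u ! j) \<longleftrightarrow> ?std u"
    (is "?ord u \<longleftrightarrow> _") for u
  proof
    assume u: "?ord u"
    then obtain n where n: "u \<in> mperms n"
      by (auto simp: all_mperms_def)
    have len: "length u = length x" using u by simp
    \<comment> \<open>The letter of \<open>x\<close> at any position where \<open>u\<close> has the
      letter \<open>k\<close>. The choice is immaterial, since equal letters of \<open>u\<close> sit
      over equal letters of \<open>x\<close>.\<close>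
    define g where "g k = x ! (SOME i. i < length x \<and> u ! i = k)" for k
    have g: "g (u ! i) = x ! i" if i: "i < length x" for i
    proof -
      let ?j = "SOME j. j < length x \<and> u ! j = u ! i"
      have j: "?j < length x \<and> u ! ?j = u ! i"
        by (rule someI[of _ i]) (simp add: i)
      have "x ! ?j \<le> x ! i \<longleftrightarrow> u ! ?j \<le> u ! i" "x ! i \<le> x ! ?j \<longleftrightarrow> u ! i \<le> u ! ?j"
        using u i j by blast+
      then show ?thesis
        using j by (simp add: g_def)
    qed
    have xg: "x = map g u"
      by (rule nth_equalityI) (simp_all add: len g)
    have mono_g: "strict_mono_on {1..n} g"
    proof (rule strict_mono_onI)
      fix k l assume kl: "k \<in> {1..n}" "l \<in> {1..n}" "k < l"
      then obtain i j where "i < length x" "u ! i = k" "j < length x" "u ! j = l"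
        using mpermsD(1)[OF n] len by (metis in_set_conv_nth)
      then show "g k < g l"
        using u kl(3) g by (metis linorder_not_le)
    qed
    have setx: "set x = g ` {1..n}"
      using mpermsD(1)[OF n] xg by (metis set_map)
    then have card: "card (set x) = n"
      using card_image[OF strict_mono_on_imp_inj_on[OF mono_g]] by simp
    have "map (enum (set x)) u = map g u"
      unfolding setx using mpermsD(1)[OF n] enum_strict_mono_image[OF mono_g] by simp
    then show "?std u"
      using n card xg by simp
  next
    assume u: "?std u"
    then have len: "length u = length x"
      by (metis length_map)
    have "x ! i \<le> x ! j \<longleftrightarrow> u ! i \<le> u ! j" if ij: "i < length x" "j < length x" for i j
    proof -
      have "x ! i = enum (set x) (u ! i)" "x ! j = enum (set x) (u ! j)"
        using u ij len by (metis nth_map)+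
      moreover have "u ! i \<in> {1..card (set x)}" "u ! j \<in> {1..card (set x)}"
        using u ij len mpermsD(1) by (metis nth_mem)+
      ultimately show ?thesis
        by (simp only: strict_mono_on_less_eq[OF mono])
    qed
    then show "?ord u"
      using u len mperms_all_mperms by blast
  qed
  let ?u = "map (inv_into {1..card (set x)} (enum (set x))) x"
  have xu: "x = map (enum (set x)) ?u"
    unfolding map_map
    by (rule map_idI[symmetric]) (simp only: comp_apply f_inv_into_f enum_image finite_set)
  have "set ?u = {1..card (set x)}"
    using inv_into_image_cancel[OF inj subset_refl] enum_image[of "set x"] by simp
  moreover have "distinct_adj ?u"
    using x xu by (metis distinct_adj_mapD)
  ultimately have ex: "?std ?u"
    using xu by (simp only: mperms_def mem_Collect_eq simp_thms)
  have uniq: "u = v" if u: "?std u" and v: "?std v" for u v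
  proof (rule map_inj_on)
    show "map (enum (set x)) u = map (enum (set x)) v"
      using u v by metis
    show "inj_on (enum (set x)) (set u \<union> set v)"
      using mpermsD(1)[of u] mpermsD(1)[of v] u v inj by (metis Un_absorb)
  qed
  have "st x = (THE u. ?std u)"
    unfolding st_def iff ..
  moreover have "?std (THE u. ?std u)"
    by (rule theI[where P = ?std, OF ex uniq[OF _ ex]])
  ultimately show ?thesis
    using uniq by metis
qed

section \<open>Cuts of a word as collapsed concatenations\<close>

lemma remdups_adj_append_distinct_adj:
  assumes "distinct_adj x" "distinct_adj y"
  shows "remdups_adj (x @ y) =
    (if x \<noteq> [] \<and> y \<noteq> [] \<and> last x = hd y then x @ tl y else x @ y)"
proof (cases "x \<noteq> [] \<and> y \<noteq> [] \<and> last x = hd y")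
  case True
  then obtain x' a y' where "x = x' @ [a]" "y = a # y'"
    by (metis append_butlast_last_id list.collapse)
  then show ?thesis
    using assms remdups_adj_append[of x' a "a # y'"] by (simp add: distinct_adj_altdef)
next
  case False
  then have "x = [] \<or> y = [] \<or> last x \<noteq> hd y" by blast
  then have "remdups_adj (x @ y) = x @ y"
    using remdups_adj_append'[of x y] assms by (simp add: distinct_adj_altdef)
  then show ?thesis
    using False by (simp only: if_False)
qed

text \<open>The length of \<open>x\<close> fixes the place of the cut, so each of the two sums
  contributes at most 1. They never contribute together: if \<open>x @ y\<close> is \<open>w\<close>
  itself, no letter is doubled at the junction. The cut with a duplicated letter is the case where
  collapsing removes one letter there.\<close>

lemma cuts_eq:
  assumes w: "distinct_adj w"
  shows "cuts w (x, y) = (if distinct_adj x \<and> distinct_adj y \<and> remdups_adj (x @ y) = w then 1 else 0)"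
proof -
  let ?glued = "x \<noteq> [] \<and> y \<noteq> [] \<and> last x = hd y \<and> x @ tl y = w"
  have "(\<Sum>i = 0..length w. basis (take i w, drop i w) (x, y)) =
      (\<Sum>i = 0..length w. if i = length x then (if x @ y = w then 1 else 0) else 0)"
    by (rule sum.cong) (auto simp: basis_def)
  also have "\<dots> = (if x @ y = w then 1 else 0)"
    by auto
  finally have 1: "(\<Sum>i = 0..length w. basis (take i w, drop i w) (x, y)) =
      (if x @ y = w then 1 else 0)" .
  have "basis (take i w, drop (i - 1) w) (x, y) =
      (if i = length x then (if ?glued then 1 else 0) else 0)"
    if i: "i \<in> {1..length w}" for i
  proof -
    have "x = take i w \<and> y = drop (i - 1) w \<longleftrightarrow> i = length x \<and> ?glued"
    proof
      assume xy: "x = take i w \<and> y = drop (i - 1) w"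
      obtain k where k: "i = Suc k" "k < length w"
        using i by (cases i) auto
      have "drop k w = w ! k # drop (Suc k) w"
        using k by (simp add: Cons_nth_drop_Suc)
      moreover have "take (Suc k) w = take k w @ [w ! k]"
        using k by (simp add: take_Suc_conv_app_nth)
      ultimately have "last x = w ! k" "x \<noteq> []" "y \<noteq> []" "hd y = w ! k" "tl y = drop (Suc k) w"
        using xy k by simp_all
      then show "i = length x \<and> ?glued"
        using xy k by simp
    next
      assume R: "i = length x \<and> ?glued"
      then obtain x' a y' where "x = x' @ [a]" "y = a # y'"
        by (metis append_butlast_last_id list.collapse)
      then show "x = take i w \<and> y = drop (i - 1) w"
        using R by auto
    qed
    then show ?thesis
      by (auto simp: basis_def)
  qed
  then have "(\<Sum>i = 1..length w. basis (take i w, drop (i - 1) w) (x, y)) =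
      (\<Sum>i = 1..length w. if i = length x then (if ?glued then 1 else 0) else 0)"
    by (intro sum.cong) auto
  also have "\<dots> = (if ?glued then 1 else 0)"
  proof -
    have "length x \<in> {1..length w}" if ?glued
      using that by (cases x; cases y) auto
    then show ?thesis
      by (simp only: sum.delta finite_atLeastAtMost) argo
  qed
  finally have 2: "(\<Sum>i = 1..length w. basis (take i w, drop (i - 1) w) (x, y)) =
      (if ?glued then 1 else 0)" .
  have glued: "distinct_adj x \<and> distinct_adj y" if g: ?glued
  proof -
    obtain x' a where x: "x = x' @ [a]"
      using g by (cases x rule: rev_cases) auto
    obtain y' where "y = a # y'"
      using g x by (cases y) auto
    with x have "w = x' @ y" "w = x @ y'" using g by auto
    then show ?thesis
      using w distinct_adj_appendD1 distinct_adj_appendD2 by metis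
  qed
  have plain: "distinct_adj x \<and> distinct_adj y \<and> \<not> (x \<noteq> [] \<and> y \<noteq> [] \<and> last x = hd y)"
    if "x @ y = w"
    using w that by (auto simp: distinct_adj_append_iff)
  have "distinct_adj x \<and> distinct_adj y \<and> remdups_adj (x @ y) = w \<longleftrightarrow> ?glued \<or> x @ y = w"
    using glued plain remdups_adj_append_distinct_adj[of x y] by (metis (full_types))
  moreover have "\<not> (?glued \<and> x @ y = w)"
    using plain by blast
  ultimately show ?thesis
    unfolding cuts_def 1 2 by auto
qed

text \<open>\<open>N\<close> counts the letters of the glued word and varies with the overlap of
  \<open>A\<close> and \<open>B\<close>, the letters used by both pieces. The union condition also
  excludes infinite sets, whose \<open>card\<close> would be 0.\<close>

definition covers :: "nat \<Rightarrow> nat \<Rightarrow> (nat set \<times> nat set) set" where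
  "covers P Q = {(A, B). card A = P \<and> card B = Q \<and> (\<exists>N. A \<union> B = {1..N})}"

definition glue :: "nat list \<Rightarrow> nat list \<Rightarrow> nat set \<times> nat set \<Rightarrow> nat list" where
  "glue p q = (\<lambda>(A, B). remdups_adj (map (enum A) p @ map (enum B) q))"

lemma coversE:
  assumes "(A, B) \<in> covers P Q"
  obtains N where "finite A" "finite B" "card A = P" "card B = Q" "A \<union> B = {1..N}"
    "card (A \<union> B) = N"
proof -
  from assms obtain N where N: "card A = P" "card B = Q" "A \<union> B = {1..N}"
    by (auto simp: covers_def)
  then have "finite A" "finite B"
    by (metis finite_Un finite_atLeastAtMost)+
  with N show ?thesis
    using that by simp
qed

lemma finite_covers: "finite (covers P Q)"
proof (rule finite_subset)
  show "covers P Q \<subseteq> Pow {1..P + Q} \<times> Pow {1..P + Q}"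
  proof clarify
    fix A B assume "(A, B) \<in> covers P Q"
    then obtain N where N: "card A = P" "card B = Q" "A \<union> B = {1..N}" "card (A \<union> B) = N"
      by (rule coversE)
    have "{1..N} \<subseteq> {1..P + Q}"
      using card_Un_le[of A B] N by simp
    then show "A \<in> Pow {1..P + Q} \<and> B \<in> Pow {1..P + Q}"
      using N(3) by blast
  qed
qed simp

lemma glue_mperms:
  assumes "(A, B) \<in> covers P Q" "p \<in> mperms P" "q \<in> mperms Q"
  shows "glue p q (A, B) \<in> mperms (card (A \<union> B))"
proof -
  obtain N where N: "finite A" "finite B" "card A = P" "card B = Q" "A \<union> B = {1..N}"
    "card (A \<union> B) = N"
    using assms(1) by (rule coversE)
  have "set (map (enum A) p) = A" "set (map (enum B) q) = B"
    using map_enum_mperms(1)[of p A] map_enum_mperms(1)[of q B] N assms by simp_all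
  then show ?thesis
    using N(5,6) by (simp add: glue_def mperms_def)
qed

text \<open>A cut with standardizations \<open>p\<close> and \<open>q\<close> is recovered from the
  letter sets of its two pieces, by relabelling \<open>p\<close> and \<open>q\<close> with the
  enumerations of these sets.\<close>

lemma card_cut_words:
  assumes p: "p \<in> mperms P" and q: "q \<in> mperms Q" and w: "w \<in> mperms N"
  shows "card {(x, y). (distinct_adj x \<and> distinct_adj y \<and> remdups_adj (x @ y) = w) \<and>
            st x = p \<and> st y = q} =
         card {c \<in> covers P Q. glue p q c = w}"
    (is "card ?W = card ?C")
proof (rule bij_betw_same_card)
  have in_C: "(set x, set y) \<in> ?C" and
    inverse: "map (enum (set x)) p = x" "map (enum (set y)) q = y" if xy: "(x, y) \<in> ?W" for x y
  proof -
    from xy have d: "distinct_adj x" "distinct_adj y" and r: "remdups_adj (x @ y) = w"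
      and st: "st x = p" "st y = q"
      by auto
    have px: "p \<in> mperms (card (set x))" "x = map (enum (set x)) p"
      and qy: "q \<in> mperms (card (set y))" "y = map (enum (set y)) q"
      using st_eq_iff[OF d(1), of p] st_eq_iff[OF d(2), of q] st by blast+
    show "map (enum (set x)) p = x" "map (enum (set y)) q = y"
      using px(2) qy(2) by simp_all
    then have "glue p q (set x, set y) = w"
      by (simp add: glue_def r)
    moreover have "set x \<union> set y = {1..N}"
      using r mpermsD(1)[OF w] by (metis remdups_adj_set set_append)
    moreover have "card (set x) = P" "card (set y) = Q"
      using mpermsD(3)[OF px(1)] mpermsD(3)[OF p] mpermsD(3)[OF qy(1)] mpermsD(3)[OF q] by simp_all
    ultimately show "(set x, set y) \<in> ?C"
      by (auto simp: covers_def)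
  qed
  have in_W: "(map (enum A) p, map (enum B) q) \<in> ?W" and
    sets: "set (map (enum A) p) = A" "set (map (enum B) q) = B" if AB: "(A, B) \<in> ?C" for A B
  proof -
    from AB obtain M where M: "finite A" "finite B" "card A = P" "card B = Q"
      by (auto elim: coversE)
    have pA: "p \<in> mperms (card A)" and qB: "q \<in> mperms (card B)"
      using p q M by simp_all
    note A = map_enum_mperms[OF pA M(1)] and B = map_enum_mperms[OF qB M(2)]
    show "set (map (enum A) p) = A" "set (map (enum B) q) = B"
      by (rule A(1), rule B(1))
    have "st (map (enum A) p) = p" "st (map (enum B) q) = q"
      unfolding st_eq_iff[OF A(2)] st_eq_iff[OF B(2)] A(1) B(1) using pA qB by simp_all
    moreover have "remdups_adj (map (enum A) p @ map (enum B) q) = w"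
      using AB by (simp add: glue_def)
    ultimately show "(map (enum A) p, map (enum B) q) \<in> ?W"
      using A(2) B(2) by blast
  qed
  show "bij_betw (\<lambda>(x, y). (set x, set y)) ?W ?C"
  proof (rule bij_betw_byWitness[where f' = "\<lambda>(A, B). (map (enum A) p, map (enum B) q)"])
    show "\<forall>xy\<in>?W. (\<lambda>(A, B). (map (enum A) p, map (enum B) q)) ((\<lambda>(x, y). (set x, set y)) xy) = xy"
      by (rule ballI) (simp only: split_paired_all split_conv inverse)
    show "\<forall>AB\<in>?C. (\<lambda>(x, y). (set x, set y)) ((\<lambda>(A, B). (map (enum A) p, map (enum B) q)) AB) = AB"
      by (rule ballI) (simp only: split_paired_all split_conv sets)
    show "(\<lambda>(x, y). (set x, set y)) ` ?W \<subseteq> ?C"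
      using in_C by (auto simp only: split_paired_all split_conv)
    show "(\<lambda>(A, B). (map (enum A) p, map (enum B) q)) ` ?C \<subseteq> ?W"
      using in_W by (auto simp only: split_paired_all split_conv)
  qed
qed

definition comult_index :: "nat list \<times> nat list \<Rightarrow> (nat set \<times> nat set) set" where
  "comult_index = (\<lambda>(p, q).
     if p \<in> all_mperms \<and> q \<in> all_mperms then covers (card (set p)) (card (set q)) else {})"

lemma finite_comult_index: "finite (comult_index pq)"
  by (cases pq) (simp add: comult_index_def finite_covers)

lemma sum_basis_eq_card: "finite I \<Longrightarrow> (\<Sum>i\<in>I. basis a (\<phi> i)) = int (card {i \<in> I. \<phi> i = a})"
  by (simp add: basis_def sum.inter_filter[symmetric])

lemma word_comult_basis_sum:
  assumes w: "w \<in> all_mperms"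
  shows "word_comult w (p, q) = (\<Sum>c\<in>comult_index (p, q). basis w (glue p q c))"
proof -
  obtain N where N: "w \<in> mperms N" using w by (auto simp: all_mperms_def)
  let ?D = "{(x, y). distinct_adj x \<and> distinct_adj y \<and> remdups_adj (x @ y) = w}"
  let ?L = "{x. set x \<subseteq> set w \<and> length x \<le> length w}"
  \<comment> \<open>Neither piece is longer than \<open>w\<close> or uses other letters, so
    \<open>?D\<close> is finite; without this \<open>Sum_any\<close> could not be replaced by a sum
    over \<open>?D\<close>.\<close>
  have "(x, y) \<in> ?L \<times> ?L" if xy: "(x, y) \<in> ?D" for x y
  proof -
    from xy have "distinct_adj x" "distinct_adj y" and r: "remdups_adj (x @ y) = w" by auto
    then have "length x \<le> length w" "length y \<le> length w"
      by (auto simp: remdups_adj_append_distinct_adj neq_Nil_conv split: if_splits)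
    moreover have "set x \<union> set y = set w"
      using r by (metis remdups_adj_set set_append)
    ultimately show ?thesis by auto
  qed
  then have "?D \<subseteq> ?L \<times> ?L" by blast
  then have fin: "finite ?D"
    by (rule finite_subset) (simp add: finite_lists_length_le)
  have cuts: "cuts w xy = (if xy \<in> ?D then 1 else 0)" for xy
    using cuts_eq[OF mpermsD(2)[OF N], of "fst xy" "snd xy"] by (simp add: case_prod_unfold)
  have "word_comult w (p, q) = Sum_any (\<lambda>xy. cuts w xy * basis (st (fst xy), st (snd xy)) (p, q))"
    by (simp only: word_comult_def extend_def case_prod_unfold)
  also have "\<dots> = (\<Sum>xy\<in>?D. cuts w xy * basis (st (fst xy), st (snd xy)) (p, q))"
    by (rule Sum_any.expand_superset[OF fin]) (use cuts in \<open>auto split: if_splits\<close>)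
  also have "\<dots> = (\<Sum>xy\<in>?D. basis (p, q) (st (fst xy), st (snd xy)))"
    by (rule sum.cong) (simp_all add: cuts basis_def eq_commute)
  also have "\<dots> = int (card {xy \<in> ?D. (st (fst xy), st (snd xy)) = (p, q)})"
    by (rule sum_basis_eq_card[OF fin])
  also have "{xy \<in> ?D. (st (fst xy), st (snd xy)) = (p, q)} =
      {(x, y). (distinct_adj x \<and> distinct_adj y \<and> remdups_adj (x @ y) = w) \<and> st x = p \<and> st y = q}"
    by auto
  also have "int (card \<dots>) = (\<Sum>c\<in>comult_index (p, q). basis w (glue p q c))"
  proof (cases "p \<in> all_mperms \<and> q \<in> all_mperms")
    case True
    then show ?thesis
      using card_cut_words[of p "card (set p)" q "card (set q)", OF _ _ N]
      by (simp add: comult_index_def finite_covers sum_basis_eq_card all_mperms_iff)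
  next
    case False
    have "st x \<in> all_mperms" if "distinct_adj x" for x
      using st_eq_iff[OF that, of "st x"] mperms_all_mperms by blast
    then have "{(x, y). (distinct_adj x \<and> distinct_adj y \<and> remdups_adj (x @ y) = w) \<and>
        st x = p \<and> st y = q} = {}"
      using False by auto
    then show ?thesis
      using False by (simp only: comult_index_def split_conv if_False card.empty of_nat_0 sum.empty)
  qed
  finally show ?thesis .
qed

lemma coeff_sum_comult: "coeff_sum all_mperms mMR_comult comult_index (\<lambda>(p, q). glue p q)"
  unfolding mMR_comult_def
  by (rule coeff_sum_extend) (auto simp: word_comult_basis_sum finite_comult_index)

section \<open>Decompositions of covers\<close>

text \<open>A composite of increasing enumerations is increasing, hence the enumeration of its
  image. This merges the nested relabellings of an iterated gluing.\<close>

lemma enum_enum: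
  assumes E: "finite E" and A: "A \<subseteq> {1..card E}" and i: "i \<in> {1..card A}"
  shows "enum (enum E ` A) i = enum E (enum A i)"
proof -
  have fin: "finite A"
    using A by (rule finite_subset) simp
  have in_A: "enum A j \<in> A" if "j \<in> {1..card A}" for j
    using that enum_image[OF fin] by blast
  have "strict_mono_on {1..card A} (\<lambda>j. enum E (enum A j))"
  proof (rule strict_mono_onI)
    fix j l assume jl: "j \<in> {1..card A}" "l \<in> {1..card A}" "j < l"
    then have "enum A j < enum A l"
      using strict_mono_onD[OF enum_strict_mono[OF fin]] by blast
    then show "enum E (enum A j) < enum E (enum A l)"
      using strict_mono_onD[OF enum_strict_mono[OF E]] in_A jl A by blast
  qed
  then have "enum ((\<lambda>j. enum E (enum A j)) ` {1..card A}) i = enum E (enum A i)"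
    using i by (rule enum_strict_mono_image)
  moreover have "(\<lambda>j. enum E (enum A j)) ` {1..card A} = enum E ` A"
    using enum_image[OF fin] by (metis image_image)
  ultimately show ?thesis by simp
qed

lemma enum_interval: "i \<in> {1..n} \<Longrightarrow> enum {1..n} i = i"
  using enum_strict_mono_image[of n "\<lambda>i. i" i] by (simp add: strict_mono_on_def)

section \<open>Covers of an interval by three sets\<close>

definition covers3 :: "nat \<Rightarrow> nat \<Rightarrow> nat \<Rightarrow> (nat set \<times> nat set \<times> nat set) set" where
  "covers3 P Q R = {(A, B, C). card A = P \<and> card B = Q \<and> card C = R \<and> (\<exists>N. A \<union> B \<union> C = {1..N})}"

lemma sum_covers_swap: "(\<Sum>(A, B)\<in>covers P Q. g A B) = (\<Sum>(B, A)\<in>covers Q P. g A B)"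
  by (rule sum.reindex_bij_witness[of _ prod.swap prod.swap]) (auto simp: covers_def Un_commute)

text \<open>\<open>sum_covers3\<close> always merges the first two sets. Rotating puts the second
  and third factor first, so that the same lemma handles the other bracketing.\<close>

lemma sum_covers3_rotate:
  "(\<Sum>(A, B, C)\<in>covers3 P Q R. g A B C) = (\<Sum>(B, C, A)\<in>covers3 Q R P. g A B C)"
  by (rule sum.reindex_bij_witness[of _ "\<lambda>(B, C, A). (A, B, C)" "\<lambda>(A, B, C). (B, C, A)"])
     (auto simp: covers3_def Un_ac)

text \<open>A triple cover is the same as the pair of \<open>A \<union> B\<close> with
  \<open>C\<close>, together with the ranks of the elements of \<open>A\<close> and of
  \<open>B\<close> inside that union. The ranks cover an initial interval, and
  \<open>?rank E\<close> inverts \<open>enum E\<close>.\<close>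

lemma sum_covers3:
  "(\<Sum>(A, B)\<in>covers P Q. \<Sum>(E, C)\<in>covers (card (A \<union> B)) R. g (enum E ` A) (enum E ` B) C) =
   (\<Sum>(A, B, C)\<in>covers3 P Q R. g A B C)"
proof -
  let ?X = "Sigma (covers P Q) (\<lambda>(A, B). covers (card (A \<union> B)) R)"
  let ?rank = "\<lambda>E. inv_into {1..card E} (enum E)"
  let ?i = "\<lambda>(A, B, C). ((?rank (A \<union> B) ` A, ?rank (A \<union> B) ` B), (A \<union> B, C))"
  let ?j = "\<lambda>((A, B), (E, C)). (enum E ` A, enum E ` B, C)"
  have inj: "inj_on (enum E) {1..card E}" if "finite E" for E
    using strict_mono_on_imp_inj_on[OF enum_strict_mono[OF that]] .
  have "(\<Sum>(A, B)\<in>covers P Q. \<Sum>(E, C)\<in>covers (card (A \<union> B)) R. g (enum E ` A) (enum E ` B) C) =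
      (\<Sum>((A, B), (E, C))\<in>?X. g (enum E ` A) (enum E ` B) C)"
    by (simp add: case_prod_unfold sum.Sigma finite_covers)
  also have "\<dots> = (\<Sum>(A, B, C)\<in>covers3 P Q R. g A B C)"
  proof (rule sum.reindex_bij_witness[of _ ?i ?j])
    fix x assume x: "x \<in> ?X"
    obtain A B E C where xeq: "x = ((A, B), (E, C))"
      by (metis surj_pair)
    have AB: "(A, B) \<in> covers P Q" and EC: "(E, C) \<in> covers (card (A \<union> B)) R"
      using x xeq by auto
    obtain N where N: "finite A" "finite B" "card A = P" "card B = Q" "A \<union> B = {1..N}"
      "card (A \<union> B) = N" using AB by (rule coversE)
    obtain M where M: "finite E" "card E = card (A \<union> B)" "card C = R" "E \<union> C = {1..M}"
      using EC by (rule coversE)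
    have EN: "card E = N" using M N by simp
    have un: "enum E ` A \<union> enum E ` B = E"
      using enum_image[OF M(1)] N(5) EN by (metis image_Un)
    have sub: "A \<subseteq> {1..card E}" "B \<subseteq> {1..card E}"
      using N(5) EN by auto
    show "?i (?j x) = x"
      by (simp add: xeq un inv_into_image_cancel[OF inj[OF M(1)]] sub del: One_nat_def)
    have "card (enum E ` A) = P" "card (enum E ` B) = Q"
      using card_image[OF inj_on_subset[OF inj[OF M(1)] sub(1)]]
        card_image[OF inj_on_subset[OF inj[OF M(1)] sub(2)]] N by simp_all
    then show "?j x \<in> covers3 P Q R"
      using M(3,4) un by (auto simp: xeq covers3_def)
    show "(\<lambda>(A, B, C). g A B C) (?j x) = (\<lambda>((A, B), (E, C)). g (enum E ` A) (enum E ` B) C) x"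
      by (simp add: xeq)
  next
    fix y assume y: "y \<in> covers3 P Q R"
    obtain A B C where yeq: "y = (A, B, C)"
      by (metis surj_pair)
    obtain N where N: "card A = P" "card B = Q" "card C = R" "A \<union> B \<union> C = {1..N}"
      using y yeq by (auto simp: covers3_def)
    let ?E = "A \<union> B"
    have fin: "finite ?E"
      using N(4) by (metis finite_Un finite_atLeastAtMost)
    note img = enum_image[OF fin]
    have cancel: "enum ?E ` ?rank ?E ` A = A" "enum ?E ` ?rank ?E ` B = B"
      using image_inv_into_cancel[of "enum ?E" "{1..card ?E}" ?E A, OF img]
        image_inv_into_cancel[of "enum ?E" "{1..card ?E}" ?E B, OF img] by auto
    show "?j (?i y) = y"
      by (simp only: yeq split_conv cancel)
    have injr: "inj_on (?rank ?E) ?E"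
      using inj_on_inv_into[of ?E "enum ?E" "{1..card ?E}"] img by simp
    have "card (?rank ?E ` A) = P" "card (?rank ?E ` B) = Q"
      using card_image[OF inj_on_subset[OF injr]] N by auto
    moreover have un: "?rank ?E ` A \<union> ?rank ?E ` B = {1..card ?E}"
      using inv_into_image_cancel[OF inj[OF fin] subset_refl] img by (metis image_Un)
    ultimately show "?i y \<in> ?X"
      using N by (auto simp: yeq covers_def)
  qed
  finally show ?thesis .
qed

section \<open>Splitting a cover at a threshold\<close>

definition lower :: "nat \<Rightarrow> nat set \<Rightarrow> nat set" where
  "lower k A = {a \<in> A. a \<le> k}"

definition upper :: "nat \<Rightarrow> nat set \<Rightarrow> nat set" where
  "upper k A = (\<lambda>a. a - k) ` {a \<in> A. k < a}"

lemma lower_un_upper: "lower k A \<union> (\<lambda>a. a + k) ` upper k A = A"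
proof -
  have "(\<lambda>a. a + k) ` upper k A = {a \<in> A. k < a}"
    by (force simp: upper_def image_image)
  then show ?thesis
    by (auto simp: lower_def)
qed

lemma lower_Un: "lower k (A \<union> B) = lower k A \<union> lower k B"
  by (auto simp: lower_def)

lemma upper_Un: "upper k (A \<union> B) = upper k A \<union> upper k B"
  by (auto simp: upper_def)

lemma lower_interval: "k \<le> N \<Longrightarrow> lower k {1..N} = {1..k}"
  by (auto simp: lower_def)

lemma upper_interval: "upper k {1..N} = {1..N - k}"
proof
  show "{1..N - k} \<subseteq> upper k {1..N}"
  proof
    fix x assume "x \<in> {1..N - k}"
    then show "x \<in> upper k {1..N}"
      unfolding upper_def by (intro rev_image_eqI[of "x + k"]) auto
  qed
qed (auto simp: upper_def)

lemma card_lower_upper: "finite A \<Longrightarrow> card (lower k A) + card (upper k A) = card A"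
proof -
  assume A: "finite A"
  have "inj_on (\<lambda>a. a - k) {a \<in> A. k < a}"
    by (auto simp: inj_on_def)
  then have "card (upper k A) = card {a \<in> A. k < a}"
    unfolding upper_def by (rule card_image)
  then have "card (lower k A) + card (upper k A) = card (lower k A \<union> {a \<in> A. k < a})"
    using A by (subst card_Un_disjoint) (auto simp: lower_def)
  also have "lower k A \<union> {a \<in> A. k < a} = A"
    by (auto simp: lower_def)
  finally show ?thesis .
qed

text \<open>The bound on \<open>A2\<close> keeps 0 out: shifted by \<open>k\<close> it would fall
  into the lower part.\<close>

lemma lower_upper_stack:
  assumes "A1 \<subseteq> {1..k}" "A2 \<subseteq> {1..}"
  shows "lower k (A1 \<union> (\<lambda>a. a + k) ` A2) = A1" "upper k (A1 \<union> (\<lambda>a. a + k) ` A2) = A2"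
proof -
  show "lower k (A1 \<union> (\<lambda>a. a + k) ` A2) = A1"
    using assms by (auto simp: lower_def)
  have "{a \<in> A1 \<union> (\<lambda>a. a + k) ` A2. k < a} = (\<lambda>a. a + k) ` A2"
    using assms by auto
  then show "upper k (A1 \<union> (\<lambda>a. a + k) ` A2) = A2"
    by (simp add: upper_def image_image)
qed

lemma interval_stack: "{1..k} \<union> (\<lambda>a. a + k) ` {1..M} = {1..k + M :: nat}"
proof -
  have "(\<lambda>a. a + k) ` {1..M} = {k + 1..k + M}"
    by (simp add: add.commute[of _ k])
  then show ?thesis by auto
qed

text \<open>A threshold cuts a cover of \<open>{1..N}\<close> into covers of \<open>{1..k}\<close>
  and, after lowering, of \<open>{1..N - k}\<close>. In the other direction the two covers are
  stacked, and \<open>k\<close> is recovered as the cardinality of the union of the lower parts;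
  \<open>n\<close> and \<open>m\<close> are the sizes of these parts.\<close>

lemma sum_covers_split:
  "(\<Sum>(A, B)\<in>covers P Q. \<Sum>k\<in>{0..card (A \<union> B)}.
      g (lower k A) (lower k B) (upper k A) (upper k B)) =
   (\<Sum>n\<in>{0..P}. \<Sum>m\<in>{0..Q}. \<Sum>(A1, B1)\<in>covers n m. \<Sum>(A2, B2)\<in>covers (P - n) (Q - m).
      g A1 B1 A2 B2)"
proof -
  let ?X = "Sigma (covers P Q) (\<lambda>(A, B). {0..card (A \<union> B)})"
  let ?Y = "Sigma ({0..P} \<times> {0..Q}) (\<lambda>(n, m). covers n m \<times> covers (P - n) (Q - m))"
  let ?up = "\<lambda>k A1 A2. A1 \<union> (\<lambda>a. a + k) ` A2"
  let ?i = "\<lambda>((n, m), (A1, B1), (A2, B2)).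
      ((?up (card (A1 \<union> B1)) A1 A2, ?up (card (A1 \<union> B1)) B1 B2), card (A1 \<union> B1))"
  let ?j = "\<lambda>((A, B), k). ((card (lower k A), card (lower k B)),
      (lower k A, lower k B), (upper k A, upper k B))"
  have "(\<Sum>(A, B)\<in>covers P Q. \<Sum>k\<in>{0..card (A \<union> B)}.
      g (lower k A) (lower k B) (upper k A) (upper k B)) =
      (\<Sum>((A, B), k)\<in>?X. g (lower k A) (lower k B) (upper k A) (upper k B))"
    by (simp add: case_prod_unfold sum.Sigma finite_covers)
  also have "\<dots> = (\<Sum>((n, m), (A1, B1), (A2, B2))\<in>?Y. g A1 B1 A2 B2)"
  proof (rule sum.reindex_bij_witness[of _ ?i ?j])
    fix x assume x: "x \<in> ?X"
    obtain A B k where xeq: "x = ((A, B), k)"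
      by (metis surj_pair)
    have AB: "(A, B) \<in> covers P Q" and k: "k \<le> card (A \<union> B)"
      using x xeq by auto
    obtain N where N: "finite A" "finite B" "card A = P" "card B = Q" "A \<union> B = {1..N}"
      "card (A \<union> B) = N" using AB by (rule coversE)
    have low: "lower k A \<union> lower k B = {1..k}"
      using lower_interval[of k N] N k lower_Un[of k A B] by simp
    have up: "upper k A \<union> upper k B = {1..N - k}"
      using upper_interval[of k N] N upper_Un[of k A B] by simp
    show "?i (?j x) = x"
      by (simp add: xeq low lower_un_upper del: One_nat_def)
    have "card (upper k A) = P - card (lower k A)" "card (upper k B) = Q - card (lower k B)"
      "card (lower k A) \<le> P" "card (lower k B) \<le> Q"
      using card_lower_upper[OF N(1), of k] card_lower_upper[OF N(2), of k] N by simp_all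
    then show "?j x \<in> ?Y"
      using low up by (auto simp: xeq covers_def)
    show "(\<lambda>((n, m), (A1, B1), (A2, B2)). g A1 B1 A2 B2) (?j x) =
        (\<lambda>((A, B), k). g (lower k A) (lower k B) (upper k A) (upper k B)) x"
      by (simp add: xeq)
  next
    fix y assume y: "y \<in> ?Y"
    obtain n m A1 B1 A2 B2 where yeq: "y = ((n, m), (A1, B1), (A2, B2))"
      by (metis surj_pair)
    have nm: "n \<le> P" "m \<le> Q" and c1: "(A1, B1) \<in> covers n m"
      and c2: "(A2, B2) \<in> covers (P - n) (Q - m)"
      using y yeq by auto
    obtain k where k: "finite A1" "finite B1" "card A1 = n" "card B1 = m" "A1 \<union> B1 = {1..k}"
      "card (A1 \<union> B1) = k" using c1 by (rule coversE)
    obtain M where M: "finite A2" "finite B2" "card A2 = P - n" "card B2 = Q - m"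
      "A2 \<union> B2 = {1..M}" using c2 by (rule coversE)
    have sub: "A1 \<subseteq> {1..k}" "B1 \<subseteq> {1..k}" "A2 \<subseteq> {1..}" "B2 \<subseteq> {1..}"
      using k(5) M(5) by auto
    note A = lower_upper_stack[OF sub(1,3)] and B = lower_upper_stack[OF sub(2,4)]
    show "?j (?i y) = y"
      by (simp add: yeq k A B)
    have "finite (?up k A1 A2)" "finite (?up k B1 B2)"
      using k M by simp_all
    then have "card (?up k A1 A2) = P" "card (?up k B1 B2) = Q"
      using card_lower_upper[of "?up k A1 A2" k] card_lower_upper[of "?up k B1 B2" k] A B k M nm
      by simp_all
    moreover have "?up k A1 A2 \<union> ?up k B1 B2 = {1..k} \<union> (\<lambda>a. a + k) ` {1..M}"
      unfolding k(5)[symmetric] M(5)[symmetric] by blast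
    then have un: "?up k A1 A2 \<union> ?up k B1 B2 = {1..k + M}"
      unfolding interval_stack .
    ultimately have "(?up k A1 A2, ?up k B1 B2) \<in> covers P Q"
      by (auto simp: covers_def)
    moreover have "k \<le> card (?up k A1 A2 \<union> ?up k B1 B2)"
      unfolding un by simp
    ultimately show "?i y \<in> ?X"
      by (simp add: yeq k)
  qed
  also have "\<dots> = (\<Sum>n\<in>{0..P}. \<Sum>m\<in>{0..Q}. \<Sum>(A1, B1)\<in>covers n m. \<Sum>(A2, B2)\<in>covers (P - n) (Q - m).
      g A1 B1 A2 B2)"
    by (subst sum.Sigma[symmetric]) (auto simp: case_prod_unfold sum.cartesian_product finite_covers)
  finally show ?thesis .
qed

section \<open>Gluing and restriction\<close>

lemma downward_closed_eq_interval:
  fixes I :: "nat set"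
  assumes I: "finite I" "0 \<notin> I" and down: "\<And>i j. i \<in> I \<Longrightarrow> 0 < j \<Longrightarrow> j \<le> i \<Longrightarrow> j \<in> I"
  shows "I = {1..card I}"
proof -
  have "I = {1..Max (insert 0 I)}"
  proof
    show "I \<subseteq> {1..Max (insert 0 I)}"
      using I by (auto simp: Suc_le_eq intro!: Max_ge Nat.gr0I)
    show "{1..Max (insert 0 I)} \<subseteq> I"
    proof
      fix j assume j: "j \<in> {1..Max (insert 0 I)}"
      have "Max (insert 0 I) \<in> insert 0 I"
        using I by (intro Max_in) auto
      then show "j \<in> I"
        using j down[of "Max (insert 0 I)" j] by auto
    qed
  qed
  then show ?thesis
    by (metis card_atLeastAtMost diff_Suc_1)
qed

text \<open>Since \<open>enum A\<close> is increasing, the indices with value at most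
  \<open>k\<close> form an initial segment. The threshold \<open>k\<close> on values therefore
  becomes the threshold \<open>card (lower k A)\<close> on indices.\<close>

lemma enum_lower_upper:
  assumes A: "finite A" and i: "i \<in> {1..card A}"
  shows "enum A i \<le> k \<longleftrightarrow> i \<le> card (lower k A)"
    and "i \<le> card (lower k A) \<Longrightarrow> enum (lower k A) i = enum A i"
    and "card (lower k A) < i \<Longrightarrow> enum (upper k A) (i - card (lower k A)) = enum A i - k"
proof -
  note mono = enum_strict_mono[OF A] and img = enum_image[OF A]
  define I where "I = {i \<in> {1..card A}. enum A i \<le> k}"
  have "{a \<in> enum A ` {1..card A}. a \<le> k} = enum A ` I"
    by (auto simp: I_def)
  then have lowI: "lower k A = enum A ` I"
    unfolding img lower_def .
  have "inj_on (enum A) I"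
    by (rule inj_on_subset[OF strict_mono_on_imp_inj_on[OF mono]]) (auto simp: I_def)
  then have cardI: "card I = card (lower k A)"
    unfolding lowI by (simp add: card_image)
  have "I = {1..card I}"
  proof (rule downward_closed_eq_interval)
    fix i j assume ij: "i \<in> I" "0 < j" "j \<le> i"
    then have "enum A j \<le> enum A i"
      using strict_mono_on_leD[OF mono, of j i] by (auto simp: I_def)
    then show "j \<in> I"
      using ij by (auto simp: I_def)
  qed (auto simp: I_def)
  then have I: "I = {1..card (lower k A)}"
    unfolding cardI .
  have iff: "enum A i \<le> k \<longleftrightarrow> i \<le> card (lower k A)" if "i \<in> {1..card A}" for i
  proof -
    have "enum A i \<le> k \<longleftrightarrow> i \<in> I"
      using that by (simp add: I_def)
    then show ?thesis
      using that unfolding I by simp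
  qed
  from i show "enum A i \<le> k \<longleftrightarrow> i \<le> card (lower k A)"
    by (rule iff)
  let ?n = "card (lower k A)"
  have n: "?n \<le> card A"
    using A by (auto simp: lower_def intro!: card_mono)
  have "strict_mono_on {1..?n} (enum A)"
    by (rule monotone_on_subset[OF mono]) (use n in auto)
  from enum_strict_mono_image[OF this, of i]
  have "enum (enum A ` {1..?n}) i = enum A i" if "i \<le> ?n"
    using that i by simp
  moreover have "enum A ` {1..?n} = lower k A"
    using lowI I by simp
  ultimately show "enum (lower k A) i = enum A i" if "i \<le> ?n"
    using that by (simp only:)
  have big: "k < enum A i" if "i \<in> {1..card A}" "?n < i" for i
    using iff[OF that(1)] that(2) by simp
  \<comment> \<open>Subtracting \<open>k\<close> preserves strict inequality here because all values
    concerned exceed \<open>k\<close>.\<close>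
  have shifted: "strict_mono_on {1..card A - ?n} (\<lambda>j. enum A (j + ?n) - k)"
  proof (rule strict_mono_onI)
    fix j l assume jl: "j \<in> {1..card A - ?n}" "l \<in> {1..card A - ?n}" "j < l"
    then have "enum A (j + ?n) < enum A (l + ?n)"
      by (intro strict_mono_onD[OF mono]) auto
    then show "enum A (j + ?n) - k < enum A (l + ?n) - k"
      using big[of "j + ?n"] jl by (intro diff_less_mono less_imp_le) auto
  qed
  have "enum ((\<lambda>j. enum A (j + ?n) - k) ` {1..card A - ?n}) (i - ?n) = enum A i - k" if lt: "?n < i"
  proof -
    have "i - ?n \<in> {1..card A - ?n}" "i - ?n + ?n = i"
      using lt i by auto
    then show ?thesis
      using enum_strict_mono_image[OF shifted, of "i - ?n"] by simp
  qed
  moreover have "(\<lambda>j. enum A (j + ?n) - k) ` {1..card A - ?n} = upper k A"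
  proof -
    have "{a \<in> enum A ` {1..card A}. k < a} = enum A ` {i \<in> {1..card A}. ?n < i}"
      using iff by (auto simp: not_le[symmetric])
    then have "{a \<in> A. k < a} = enum A ` {i \<in> {1..card A}. ?n < i}"
      unfolding img .
    also have "{i \<in> {1..card A}. ?n < i} = (\<lambda>j. j + ?n) ` {1..card A - ?n}"
    proof
      show "{i \<in> {1..card A}. ?n < i} \<subseteq> (\<lambda>j. j + ?n) ` {1..card A - ?n}"
      proof
        fix i assume "i \<in> {i \<in> {1..card A}. ?n < i}"
        then show "i \<in> (\<lambda>j. j + ?n) ` {1..card A - ?n}"
          by (intro rev_image_eqI[of "i - ?n"]) auto
      qed
    qed auto
    finally show ?thesis
      by (simp only: upper_def image_image)
  qed
  ultimately show "enum (upper k A) (i - ?n) = enum A i - k" if "?n < i"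
    using that by simp
qed

lemma filter_map_enum:
  assumes A: "finite A" and p: "p \<in> mperms (card A)"
  shows "filter (\<lambda>a. a \<le> k) (map (enum A) p) =
      map (enum (lower k A)) (filter (\<lambda>a. a \<le> card (lower k A)) p)"
    and "map (\<lambda>a. a - k) (filter (\<lambda>a. k < a) (map (enum A) p)) =
      map (enum (upper k A)) (map (\<lambda>a. a - card (lower k A)) (filter (\<lambda>a. card (lower k A) < a) p))"
proof -
  let ?n = "card (lower k A)"
  note E = enum_lower_upper[OF A, folded mpermsD(1)[OF p]]
  have "filter (\<lambda>a. a \<le> k) (map (enum A) p) = map (enum A) (filter (\<lambda>a. a \<le> ?n) p)"
    using E(1) by (simp add: filter_map comp_def cong: filter_cong)
  also have "\<dots> = map (enum (lower k A)) (filter (\<lambda>a. a \<le> ?n) p)"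
    using E(2) by simp
  finally show "filter (\<lambda>a. a \<le> k) (map (enum A) p) = map (enum (lower k A)) (filter (\<lambda>a. a \<le> ?n) p)" .
  have "filter (\<lambda>a. k < a) (map (enum A) p) = map (enum A) (filter (\<lambda>a. ?n < a) p)"
    using E(1) by (simp add: filter_map comp_def not_le[symmetric] cong: filter_cong)
  then show "map (\<lambda>a. a - k) (filter (\<lambda>a. k < a) (map (enum A) p)) =
      map (enum (upper k A)) (map (\<lambda>a. a - ?n) (filter (\<lambda>a. ?n < a) p))"
    using E(3) by simp
qed

lemma remdups_adj_append_map:
  "remdups_adj (map f (remdups_adj p) @ map g (remdups_adj q)) = remdups_adj (map f p @ map g q)"
  by (metis remdups_adj_append_remdups_adj_left remdups_adj_append_remdups_adj_right remdups_adj_map)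

text \<open>The core of the compatibility axiom: restricting a glued word restricts \<open>p\<close>
  and \<open>q\<close> separately, each at its own threshold, given by how many elements of its
  letter set are at most \<open>k\<close>.\<close>

lemma low_high_glue:
  assumes AB: "(A, B) \<in> covers P Q" and p: "p \<in> mperms P" and q: "q \<in> mperms Q"
  shows "low k (glue p q (A, B)) =
      glue (low (card (lower k A)) p) (low (card (lower k B)) q) (lower k A, lower k B)"
    and "high k (glue p q (A, B)) =
      glue (high (card (lower k A)) p) (high (card (lower k B)) q) (upper k A, upper k B)"
proof -
  obtain N where N: "finite A" "finite B" "card A = P" "card B = Q"
    using AB by (rule coversE)
  have pA: "p \<in> mperms (card A)" and qB: "q \<in> mperms (card B)"
    using p q N by simp_all
  note A = filter_map_enum[OF N(1) pA, of k] and B = filter_map_enum[OF N(2) qB, of k]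
  show "low k (glue p q (A, B)) =
      glue (low (card (lower k A)) p) (low (card (lower k B)) q) (lower k A, lower k B)"
    unfolding glue_def split_conv low_def remdups_adj_append_map remdups_adj_filter filter_append A(1) B(1) ..
  show "high k (glue p q (A, B)) =
      glue (high (card (lower k A)) p) (high (card (lower k B)) q) (upper k A, upper k B)"
    unfolding glue_def split_conv high_def remdups_adj_append_map remdups_adj_map_filter
      filter_append map_append A(2) B(2) ..
qed

section \<open>The bialgebra axioms\<close>

lemma tensor_map_eq:
  assumes "coeff_sum S F I \<phi>" "coeff_sum T G J \<psi>" "t \<in> cfree (S \<times> T)"
  shows "tensor_map F G t (c, d) = (\<Sum>i\<in>I c. \<Sum>j\<in>J d. t (\<phi> c i, \<psi> d j))"
  using coeff_sumD(2)[OF coeff_sum_tensor_map[OF assms(1,2)] assms(3), of "(c, d)"]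
  by (simp add: sum.cartesian_product case_prod_unfold)

lemmas tensor_map_id_right = tensor_map_eq[OF _ coeff_sum_id, simplified]
lemmas tensor_map_id_left = tensor_map_eq[OF coeff_sum_id, simplified]

text \<open>The coefficient formulas apply to elements supported on m-permutations, so this is
  required for the intermediate tensors in the axioms.\<close>

lemma tensor_map_in_cfree:
  assumes F: "\<And>a. a \<in> S \<Longrightarrow> F (basis a) \<in> cfree S'" and G: "\<And>b. b \<in> T \<Longrightarrow> G (basis b) \<in> cfree T'"
    and t: "t \<in> cfree (S \<times> T)"
  shows "tensor_map F G t \<in> cfree (S' \<times> T')"
proof -
  have "tensor_map F G t (c, d) = 0" if cd: "(c, d) \<notin> S' \<times> T'" for c d
  proof -
    have "t p * (F (basis (fst p)) c * G (basis (snd p)) d) = 0" for p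
    proof (cases "p \<in> S \<times> T")
      case True
      then have "F (basis (fst p)) c = 0 \<or> G (basis (snd p)) d = 0"
        using cfree_outside[OF F, of "fst p" c] cfree_outside[OF G, of "snd p" d] cd by auto
      then show ?thesis by auto
    next
      case False
      then show ?thesis using cfree_outside[OF t] by simp
    qed
    then show ?thesis
      unfolding tensor_map_def extend_def tensor_def case_prod_unfold fst_conv snd_conv
      by (simp only: Sum_any.neutral)
  qed
  then show ?thesis
    by (fastforce simp: cfree_def)
qed

lemma mult_eq:
  assumes "t \<in> cfree (all_mperms \<times> all_mperms)"
  shows "mMR_mult t w = (\<Sum>n\<in>mult_index w. t (low n w, high n w))"
  by (rule coeff_sumD(2)[OF coeff_sum_mult assms])

lemma comult_eq:
  assumes "x \<in> cfree all_mperms"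
  shows "mMR_comult x (p, q) = (\<Sum>c\<in>comult_index (p, q). x (glue p q c))"
  using coeff_sumD(2)[OF coeff_sum_comult assms, of "(p, q)"] by simp

lemma mult_in_cfree: "t \<in> cfree (all_mperms \<times> all_mperms) \<Longrightarrow> mMR_mult t \<in> cfree all_mperms"
  by (rule coeff_sum_in_cfree[OF coeff_sum_mult]) (simp_all add: mult_index_def)

lemma comult_in_cfree: "x \<in> cfree all_mperms \<Longrightarrow> mMR_comult x \<in> cfree (all_mperms \<times> all_mperms)"
  by (rule coeff_sum_in_cfree[OF coeff_sum_comult]) (auto simp: comult_index_def split: if_splits)

lemma mult_index_mperms: "w \<in> mperms N \<Longrightarrow> mult_index w = {0..N}"
  using mperms_all_mperms mpermsD(3) by (simp add: mult_index_def)

lemma comult_index_mperms: "p \<in> mperms P \<Longrightarrow> q \<in> mperms Q \<Longrightarrow> comult_index (p, q) = covers P Q"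
  using mperms_all_mperms mpermsD(3) by (simp add: comult_index_def)

lemma comult_index_empty: "p \<notin> all_mperms \<or> q \<notin> all_mperms \<Longrightarrow> comult_index (p, q) = {}"
  by (auto simp: comult_index_def)

section \<open>Associativity of the product\<close>

lemma mult_assoc:
  assumes t: "t \<in> cfree ((all_mperms \<times> all_mperms) \<times> all_mperms)"
  shows "mMR_mult (tensor_map mMR_mult id t) = mMR_mult (tensor_map id mMR_mult (reassoc t))"
proof
  fix w
  have t': "reassoc t \<in> cfree (all_mperms \<times> (all_mperms \<times> all_mperms))"
    using t by (auto simp: cfree_def reassoc_def)
  have L: "tensor_map mMR_mult id t \<in> cfree (all_mperms \<times> all_mperms)"
    by (rule tensor_map_in_cfree[OF _ _ t]) (auto intro!: mult_in_cfree basis_in_cfree)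
  have R: "tensor_map id mMR_mult (reassoc t) \<in> cfree (all_mperms \<times> all_mperms)"
    by (rule tensor_map_in_cfree[OF _ _ t']) (auto intro!: mult_in_cfree basis_in_cfree)
  show "mMR_mult (tensor_map mMR_mult id t) w = mMR_mult (tensor_map id mMR_mult (reassoc t)) w"
  proof (cases "w \<in> all_mperms")
    case True
    then obtain N where N: "w \<in> mperms N" by (auto simp: all_mperms_def)
    let ?g = "\<lambda>m k. t ((low m w, low k (high m w)), high (m + k) w)"
    have "mMR_mult (tensor_map mMR_mult id t) w =
        (\<Sum>n\<in>{0..N}. \<Sum>m\<in>mult_index (low n w). t ((low m (low n w), high m (low n w)), high n w))"
      by (simp add: mult_eq[OF L] mult_index_mperms[OF N] tensor_map_id_right[OF coeff_sum_mult t])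
    also have "\<dots> = (\<Sum>n\<in>{0..N}. \<Sum>m\<in>{0..n}. ?g m (n - m))"
      using mult_index_mperms[OF low_mperms[OF N]] by (intro sum.cong) (simp_all add: low_low high_low)
    also have "\<dots> = (\<Sum>(n, m)\<in>Sigma {0..N} (\<lambda>n. {0..n}). ?g m (n - m))"
      by (rule sum.Sigma) auto
    \<comment> \<open>Both bracketings cut the letters at two thresholds \<open>m \<le> n\<close>.
      The left one chooses \<open>n\<close> and then \<open>m\<close>, the right one
      \<open>m\<close> and then the distance \<open>k = n - m\<close>.\<close>
    also have "\<dots> = (\<Sum>(m, k)\<in>Sigma {0..N} (\<lambda>m. {0..N - m}). ?g m k)"
      by (rule sum.reindex_bij_witness[of _ "\<lambda>(m, k). (m + k, m)" "\<lambda>(n, m). (m, n - m)"]) auto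
    also have "\<dots> = (\<Sum>m\<in>{0..N}. \<Sum>k\<in>{0..N - m}. ?g m k)"
      by (rule sum.Sigma[symmetric]) auto
    also have "\<dots> = (\<Sum>m\<in>{0..N}. \<Sum>k\<in>mult_index (high m w).
        reassoc t (low m w, (low k (high m w), high k (high m w))))"
      using mult_index_mperms[OF high_mperms[OF N]]
      by (intro sum.cong) (simp_all add: reassoc_def high_high)
    also have "\<dots> = mMR_mult (tensor_map id mMR_mult (reassoc t)) w"
      by (simp add: mult_eq[OF R] mult_index_mperms[OF N] tensor_map_id_left[OF coeff_sum_mult t'])
    finally show ?thesis .
  qed (simp add: mult_eq[OF L] mult_eq[OF R] mult_index_def)
qed

section \<open>The unit axioms\<close>

lemma Nil_mperms: "[] \<in> mperms n \<longleftrightarrow> n = 0"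
  by (auto simp: mperms_def)

lemma Nil_all_mperms: "[] \<in> all_mperms"
  using Nil_mperms mperms_all_mperms by blast

lemma mperms_0: "w \<in> mperms 0 \<longleftrightarrow> w = []"
  by (auto simp: mperms_def)

lemma low_all: "w \<in> mperms N \<Longrightarrow> low N w = w"
  by (auto simp: low_def mperms_def distinct_adj_altdef[symmetric] intro!: filter_True)

lemma high_0: "w \<in> mperms N \<Longrightarrow> high 0 w = w"
  by (auto simp: high_def mperms_def distinct_adj_altdef[symmetric] intro!: filter_True)

lemma unit_in_cfree: "mMR_unit n \<in> cfree all_mperms"
  using Nil_all_mperms by (auto simp: cfree_def mMR_unit_def basis_def split: if_splits)

lemma tensor_in_cfree: "x \<in> cfree A \<Longrightarrow> y \<in> cfree B \<Longrightarrow> tensor x y \<in> cfree (A \<times> B)"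
  by (auto simp: cfree_def tensor_def)

lemma unit_left:
  assumes x: "x \<in> cfree all_mperms"
  shows "mMR_mult (tensor (mMR_unit n) x) = (\<lambda>w. n * x w)"
proof
  fix w
  note T = tensor_in_cfree[OF unit_in_cfree x, of n]
  show "mMR_mult (tensor (mMR_unit n) x) w = n * x w"
  proof (cases "w \<in> all_mperms")
    case True
    then obtain N where N: "w \<in> mperms N" by (auto simp: all_mperms_def)
    have "low k w = [] \<longleftrightarrow> k = 0" if "k \<le> N" for k
      using low_mperms[OF N that] Nil_mperms mperms_0 by metis
    then have "(\<Sum>k\<in>{0..N}. mMR_unit n (low k w) * x (high k w)) =
        (\<Sum>k\<in>{0..N}. if k = 0 then n * x (high k w) else 0)"
      by (intro sum.cong) (auto simp: mMR_unit_def basis_def)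
    then show ?thesis
      unfolding mult_eq[OF T] mult_index_mperms[OF N] by (simp add: tensor_def high_0[OF N])
  qed (simp add: mult_eq[OF T] mult_index_def cfree_outside[OF x])
qed

lemma unit_right:
  assumes x: "x \<in> cfree all_mperms"
  shows "mMR_mult (tensor x (mMR_unit n)) = (\<lambda>w. n * x w)"
proof
  fix w
  note T = tensor_in_cfree[OF x unit_in_cfree, of n]
  show "mMR_mult (tensor x (mMR_unit n)) w = n * x w"
  proof (cases "w \<in> all_mperms")
    case True
    then obtain N where N: "w \<in> mperms N" by (auto simp: all_mperms_def)
    have "high k w = [] \<longleftrightarrow> k = N" if k: "k \<le> N" for k
    proof -
      have "high k w = [] \<longleftrightarrow> N - k = 0"
        using high_mperms[OF N k] Nil_mperms mperms_0 by metis
      then show ?thesis using k by auto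
    qed
    then have "(\<Sum>k\<in>{0..N}. x (low k w) * mMR_unit n (high k w)) =
        (\<Sum>k\<in>{0..N}. if k = N then n * x (low k w) else 0)"
      by (intro sum.cong) (auto simp: mMR_unit_def basis_def)
    then show ?thesis
      unfolding mult_eq[OF T] mult_index_mperms[OF N] by (simp add: tensor_def low_all[OF N])
  qed (simp add: mult_eq[OF T] mult_index_def cfree_outside[OF x])
qed

section \<open>Coassociativity of the coproduct\<close>

lemma glue_glue_left:
  assumes AB: "(A, B) \<in> covers P Q" and EC: "(E, C) \<in> covers (card (A \<union> B)) R"
    and p: "p \<in> mperms P" and q: "q \<in> mperms Q"
  shows "glue (glue p q (A, B)) r (E, C) =
    remdups_adj (map (enum (enum E ` A)) p @ map (enum (enum E ` B)) q @ map (enum C) r)"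
proof -
  obtain N where N: "card A = P" "card B = Q" "A \<union> B = {1..N}" "card (A \<union> B) = N"
    using AB by (rule coversE)
  obtain M where M: "finite E" "card E = card (A \<union> B)"
    using EC by (rule coversE)
  have sub: "A \<subseteq> {1..card E}" "B \<subseteq> {1..card E}"
    using N M by auto
  have A: "map (enum E) (map (enum A) p) = map (enum (enum E ` A)) p"
    using enum_enum[OF M(1) sub(1)] mpermsD(1)[OF p] N by simp
  have B: "map (enum E) (map (enum B) q) = map (enum (enum E ` B)) q"
    using enum_enum[OF M(1) sub(2)] mpermsD(1)[OF q] N by simp
  have "glue (glue p q (A, B)) r (E, C) =
      remdups_adj (map (enum E) (map (enum A) p @ map (enum B) q) @ map (enum C) r)"
    unfolding glue_def split_conv
    by (metis remdups_adj_append_remdups_adj_left remdups_adj_map)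
  then show ?thesis
    by (simp only: map_append A B append_assoc)
qed

text \<open>The cover is given as \<open>(F, A)\<close>, merged block first, to fit
  \<open>sum_covers3\<close> after rotation, although the gluing takes the sets as
  \<open>(A, F)\<close>; \<open>sum_covers_swap\<close> bridges the two orders.\<close>

lemma glue_glue_right:
  assumes BC: "(B, C) \<in> covers Q R" and FA: "(F, A) \<in> covers (card (B \<union> C)) P"
    and q: "q \<in> mperms Q" and r: "r \<in> mperms R"
  shows "glue p (glue q r (B, C)) (A, F) =
    remdups_adj (map (enum A) p @ map (enum (enum F ` B)) q @ map (enum (enum F ` C)) r)"
proof -
  obtain N where N: "card B = Q" "card C = R" "B \<union> C = {1..N}" "card (B \<union> C) = N"
    using BC by (rule coversE)
  obtain M where M: "finite F" "card F = card (B \<union> C)"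
    using FA by (rule coversE)
  have sub: "B \<subseteq> {1..card F}" "C \<subseteq> {1..card F}"
    using N M by auto
  have B: "map (enum F) (map (enum B) q) = map (enum (enum F ` B)) q"
    using enum_enum[OF M(1) sub(1)] mpermsD(1)[OF q] N by simp
  have C: "map (enum F) (map (enum C) r) = map (enum (enum F ` C)) r"
    using enum_enum[OF M(1) sub(2)] mpermsD(1)[OF r] N by simp
  have "glue p (glue q r (B, C)) (A, F) =
      remdups_adj (map (enum A) p @ map (enum F) (map (enum B) q @ map (enum C) r))"
    unfolding glue_def split_conv
    by (metis remdups_adj_append_remdups_adj_right remdups_adj_map)
  then show ?thesis
    by (simp only: map_append B C)
qed

text \<open>Either iterated coproduct evaluates \<open>x\<close> at one collapsed concatenation of
  relabelled copies of \<open>p\<close>, \<open>q\<close>, \<open>r\<close>. It depends only on the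
  three letter sets, so both sums run over \<open>covers3\<close>.\<close>

lemma comult_coassoc:
  assumes x: "x \<in> cfree all_mperms"
  shows "reassoc (tensor_map mMR_comult id (mMR_comult x)) = tensor_map id mMR_comult (mMR_comult x)"
proof -
  note D = comult_in_cfree[OF x]
  have "tensor_map mMR_comult id (mMR_comult x) ((p, q), r) =
      tensor_map id mMR_comult (mMR_comult x) (p, (q, r))" for p q r
  proof -
    have L: "tensor_map mMR_comult id (mMR_comult x) ((p, q), r) =
        (\<Sum>c\<in>comult_index (p, q). \<Sum>e\<in>comult_index (glue p q c, r). x (glue (glue p q c) r e))"
      by (simp add: tensor_map_id_right[OF coeff_sum_comult D] comult_eq[OF x])
    have R: "tensor_map id mMR_comult (mMR_comult x) (p, (q, r)) =
        (\<Sum>c\<in>comult_index (q, r). \<Sum>e\<in>comult_index (p, glue q r c). x (glue p (glue q r c) e))"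
      by (simp add: tensor_map_id_left[OF coeff_sum_comult D] comult_eq[OF x])
    show ?thesis
    proof (cases "p \<in> all_mperms \<and> q \<in> all_mperms \<and> r \<in> all_mperms")
      case True
      then obtain P Q R' where p: "p \<in> mperms P" and q: "q \<in> mperms Q" and r: "r \<in> mperms R'"
        by (auto simp: all_mperms_def)
      let ?g = "\<lambda>A B C. x (remdups_adj (map (enum A) p @ map (enum B) q @ map (enum C) r))"
      have "(\<Sum>e\<in>comult_index (glue p q c, r). x (glue (glue p q c) r e)) =
          (\<lambda>(A, B). \<Sum>(E, C)\<in>covers (card (A \<union> B)) R'. ?g (enum E ` A) (enum E ` B) C) c"
        if c: "c \<in> covers P Q" for c
      proof -
        obtain A B where [simp]: "c = (A, B)" by (cases c)
        show ?thesis
          using c glue_glue_left[OF _ _ p q, of A B _ _ R' r]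
          by (auto simp: comult_index_mperms[OF glue_mperms[OF _ p q] r] intro!: sum.cong)
      qed
      then have "tensor_map mMR_comult id (mMR_comult x) ((p, q), r) =
          (\<Sum>(A, B)\<in>covers P Q. \<Sum>(E, C)\<in>covers (card (A \<union> B)) R'. ?g (enum E ` A) (enum E ` B) C)"
        unfolding L comult_index_mperms[OF p q] by (rule sum.cong[OF refl])
      also have "\<dots> = (\<Sum>(A, B, C)\<in>covers3 P Q R'. ?g A B C)"
        by (rule sum_covers3)
      also have "\<dots> = (\<Sum>(B, C, A)\<in>covers3 Q R' P. ?g A B C)"
        by (rule sum_covers3_rotate)
      also have "\<dots> = (\<Sum>(B, C)\<in>covers Q R'. \<Sum>(F, A)\<in>covers (card (B \<union> C)) P.
          ?g A (enum F ` B) (enum F ` C))"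
        by (rule sum_covers3[symmetric])
      also have "\<dots> = tensor_map id mMR_comult (mMR_comult x) (p, (q, r))"
        unfolding R comult_index_mperms[OF q r]
      proof (rule sum.cong[OF refl])
        fix c assume c: "c \<in> covers Q R'"
        obtain B C where [simp]: "c = (B, C)" by (cases c)
        have "(\<Sum>(F, A)\<in>covers (card (B \<union> C)) P. ?g A (enum F ` B) (enum F ` C)) =
            (\<Sum>(F, A)\<in>covers (card (B \<union> C)) P. x (glue p (glue q r (B, C)) (A, F)))"
          using c glue_glue_right[OF _ _ q r, of B C _ _ P p] by (auto intro!: sum.cong)
        also have "\<dots> = (\<Sum>(A, F)\<in>covers P (card (B \<union> C)). x (glue p (glue q r (B, C)) (A, F)))"
          by (rule sum_covers_swap)
        finally show "(\<lambda>(B, C). \<Sum>(F, A)\<in>covers (card (B \<union> C)) P. ?g A (enum F ` B) (enum F ` C)) c =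
            (\<Sum>e\<in>comult_index (p, glue q r c). x (glue p (glue q r c) e))"
          using c by (simp add: comult_index_mperms[OF p glue_mperms[OF _ q r]] case_prod_unfold)
      qed
      finally show ?thesis .
    next
      case False
      then show ?thesis
        unfolding L R by (auto simp: comult_index_empty)
    qed
  qed
  then show ?thesis
    by (auto simp: reassoc_def fun_eq_iff)
qed

section \<open>The counit axioms\<close>

lemma Sum_any_basis_single: "Sum_any (\<lambda>a. c a * basis a b) = c b"
  using Sum_any_basis_sum[of "{()}" c "\<lambda>_. b"] by simp

lemma map_enum_interval:
  assumes "w \<in> mperms N"
  shows "map (enum {1..N}) w = w"
  using mpermsD(1)[OF assms] by (intro map_idI enum_interval) simp

lemma covers_0_left: "covers 0 N = {({}, {1..N})}"
proof
  show "covers 0 N \<subseteq> {({}, {1..N})}"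
  proof clarify
    fix A B assume "(A, B) \<in> covers 0 N"
    then show "A = {} \<and> B = {1..N}"
      by (rule coversE) auto
  qed
qed (auto simp: covers_def)

lemma covers_0_right: "covers N 0 = {({1..N}, {})}"
proof
  show "covers N 0 \<subseteq> {({1..N}, {})}"
  proof clarify
    fix A B assume "(A, B) \<in> covers N 0"
    then show "A = {1..N} \<and> B = {}"
      by (rule coversE) auto
  qed
qed (auto simp: covers_def)

text \<open>The counit selects the coefficient at \<open>([], w)\<close>. The only cover with empty
  first set is \<open>({}, {1..N})\<close>, and enumerating a full interval leaves \<open>w\<close>
  unchanged.\<close>

lemma counit_left:
  assumes x: "x \<in> cfree all_mperms"
  shows "extend (\<lambda>(a, b) c. mMR_counit (basis a) * basis b c) (mMR_comult x) = x"
proof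
  fix w
  have "extend (\<lambda>(a, b) c. mMR_counit (basis a) * basis b c) (mMR_comult x) w =
      Sum_any (\<lambda>p. mMR_comult x p * basis p ([], w))"
    unfolding extend_def
    by (rule Sum_any.cong) (simp add: case_prod_unfold mMR_counit_def flip: basis_pair)
  also have "\<dots> = mMR_comult x ([], w)"
    by (rule Sum_any_basis_single)
  also have "\<dots> = x w"
  proof (cases "w \<in> all_mperms")
    case True
    then obtain N where N: "w \<in> mperms N" by (auto simp: all_mperms_def)
    show ?thesis
      using N map_enum_interval[OF N] mpermsD(2)[OF N] Nil_mperms[of 0]
      by (simp add: comult_eq[OF x] comult_index_mperms[of "[]" 0 w N] covers_0_left glue_def distinct_adj_altdef)
  next
    case False
    then show ?thesis
      using cfree_outside[OF x] cfree_outside[OF comult_in_cfree[OF x], of "([], w)"] by simp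
  qed
  finally show "extend (\<lambda>(a, b) c. mMR_counit (basis a) * basis b c) (mMR_comult x) w = x w" .
qed

lemma counit_right:
  assumes x: "x \<in> cfree all_mperms"
  shows "extend (\<lambda>(a, b) c. basis a c * mMR_counit (basis b)) (mMR_comult x) = x"
proof
  fix w
  have "extend (\<lambda>(a, b) c. basis a c * mMR_counit (basis b)) (mMR_comult x) w =
      Sum_any (\<lambda>p. mMR_comult x p * basis p (w, []))"
    unfolding extend_def
    by (rule Sum_any.cong) (simp add: case_prod_unfold mMR_counit_def flip: basis_pair)
  also have "\<dots> = mMR_comult x (w, [])"
    by (rule Sum_any_basis_single)
  also have "\<dots> = x w"
  proof (cases "w \<in> all_mperms")
    case True
    then obtain N where N: "w \<in> mperms N" by (auto simp: all_mperms_def)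
    show ?thesis
      using N map_enum_interval[OF N] mpermsD(2)[OF N] Nil_mperms[of 0]
      by (simp add: comult_eq[OF x] comult_index_mperms[of w N "[]" 0] covers_0_right glue_def distinct_adj_altdef)
  next
    case False
    then show ?thesis
      using cfree_outside[OF x] cfree_outside[OF comult_in_cfree[OF x], of "(w, [])"] by simp
  qed
  finally show "extend (\<lambda>(a, b) c. basis a c * mMR_counit (basis b)) (mMR_comult x) w = x w" .
qed

section \<open>Compatibility of the coproduct with the product\<close>

lemma comult_mult:
  assumes t: "t \<in> cfree (all_mperms \<times> all_mperms)"
  shows "mMR_comult (mMR_mult t) =
    tensor_map mMR_mult mMR_mult (swap_middle (tensor_map mMR_comult mMR_comult t))"
proof -
  let ?s = "swap_middle (tensor_map mMR_comult mMR_comult t)"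
  have "tensor_map mMR_comult mMR_comult t \<in> cfree ((all_mperms \<times> all_mperms) \<times> (all_mperms \<times> all_mperms))"
    by (rule tensor_map_in_cfree[OF _ _ t]) (auto intro!: comult_in_cfree basis_in_cfree)
  then have s: "?s \<in> cfree ((all_mperms \<times> all_mperms) \<times> (all_mperms \<times> all_mperms))"
    by (auto simp: cfree_def swap_middle_def)
  have "mMR_comult (mMR_mult t) (p, q) = tensor_map mMR_mult mMR_mult ?s (p, q)" for p q
  proof -
    have L: "mMR_comult (mMR_mult t) (p, q) =
        (\<Sum>c\<in>comult_index (p, q). \<Sum>k\<in>mult_index (glue p q c).
           t (low k (glue p q c), high k (glue p q c)))"
      by (simp add: comult_eq[OF mult_in_cfree[OF t]] mult_eq[OF t])
    have R: "tensor_map mMR_mult mMR_mult ?s (p, q) =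
        (\<Sum>n\<in>mult_index p. \<Sum>m\<in>mult_index q.
           \<Sum>c\<in>comult_index (low n p, low m q). \<Sum>e\<in>comult_index (high n p, high m q).
             t (glue (low n p) (low m q) c, glue (high n p) (high m q) e))"
      unfolding tensor_map_eq[OF coeff_sum_mult coeff_sum_mult s]
      by (simp add: swap_middle_def tensor_map_eq[OF coeff_sum_comult coeff_sum_comult t])
    show ?thesis
    proof (cases "p \<in> all_mperms \<and> q \<in> all_mperms")
      case True
      then obtain P Q where p: "p \<in> mperms P" and q: "q \<in> mperms Q"
        by (auto simp: all_mperms_def)
      \<comment> \<open>The thresholds are written as \<open>card A1\<close> and
        \<open>card B1\<close> in order that the summand depend on the four sets alone. On the
        right-hand side these cardinalities are \<open>n\<close> and \<open>m\<close> by membership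
        in \<open>covers n m\<close>.\<close>
      let ?g = "\<lambda>A1 B1 A2 B2. t (glue (low (card A1) p) (low (card B1) q) (A1, B1),
          glue (high (card A1) p) (high (card B1) q) (A2, B2))"
      have "mMR_comult (mMR_mult t) (p, q) =
          (\<Sum>(A, B)\<in>covers P Q. \<Sum>k\<in>{0..card (A \<union> B)}.
             ?g (lower k A) (lower k B) (upper k A) (upper k B))"
        unfolding L comult_index_mperms[OF p q]
      proof (rule sum.cong[OF refl])
        fix c assume c: "c \<in> covers P Q"
        obtain A B where [simp]: "c = (A, B)" by (cases c)
        show "(\<Sum>k\<in>mult_index (glue p q c). t (low k (glue p q c), high k (glue p q c))) =
            (\<lambda>(A, B). \<Sum>k\<in>{0..card (A \<union> B)}. ?g (lower k A) (lower k B) (upper k A) (upper k B)) c"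
          using c by (simp add: mult_index_mperms[OF glue_mperms[OF _ p q]] low_high_glue[OF _ p q])
      qed
      also have "\<dots> = (\<Sum>n\<in>{0..P}. \<Sum>m\<in>{0..Q}.
          \<Sum>(A1, B1)\<in>covers n m. \<Sum>(A2, B2)\<in>covers (P - n) (Q - m). ?g A1 B1 A2 B2)"
        by (rule sum_covers_split)
      also have "\<dots> = tensor_map mMR_mult mMR_mult ?s (p, q)"
        unfolding R mult_index_mperms[OF p] mult_index_mperms[OF q]
      proof (intro sum.cong refl)
        fix n m c assume n: "n \<in> {0..P}" and m: "m \<in> {0..Q}"
        have nP: "n \<le> P" and mQ: "m \<le> Q" using n m by auto
        have idx: "comult_index (low n p, low m q) = covers n m"
          "comult_index (high n p, high m q) = covers (P - n) (Q - m)"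
          by (rule comult_index_mperms[OF low_mperms[OF p nP] low_mperms[OF q mQ]],
              rule comult_index_mperms[OF high_mperms[OF p nP] high_mperms[OF q mQ]])
        show "covers n m = comult_index (low n p, low m q)"
          by (simp only: idx)
        assume "c \<in> comult_index (low n p, low m q)"
        then obtain A1 B1 where c: "c = (A1, B1)" "card A1 = n" "card B1 = m"
          by (auto simp: idx covers_def)
        show "(\<lambda>(A1, B1). \<Sum>(A2, B2)\<in>covers (P - n) (Q - m). ?g A1 B1 A2 B2) c =
            (\<Sum>e\<in>comult_index (high n p, high m q).
               t (glue (low n p) (low m q) c, glue (high n p) (high m q) e))"
          by (simp add: c idx case_prod_unfold)
      qed
      finally show ?thesis .
    next
      case False
      then show ?thesis
        unfolding L R by (auto simp: comult_index_empty mult_index_def)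
    qed
  qed
  then show ?thesis
    by (auto simp: fun_eq_iff)
qed

section \<open>The counit of a product and the coproduct of the unit\<close>

lemma counit_mult:
  assumes t: "t \<in> cfree (all_mperms \<times> all_mperms)"
  shows "mMR_counit (mMR_mult t) =
    Sum_any (\<lambda>(a, b). t (a, b) * (mMR_counit (basis a) * mMR_counit (basis b)))"
proof -
  have "Sum_any (\<lambda>(a, b). t (a, b) * (mMR_counit (basis a) * mMR_counit (basis b))) =
      Sum_any (\<lambda>p. t p * basis p ([], []))"
    by (rule Sum_any.cong) (simp add: case_prod_unfold mMR_counit_def flip: basis_pair)
  also have "\<dots> = t ([], [])"
    by (rule Sum_any_basis_single)
  also have "\<dots> = mMR_counit (mMR_mult t)"
    using Nil_mperms[of 0]
    by (simp add: mMR_counit_def mult_eq[OF t] mult_index_mperms[of "[]" 0] low_def high_def)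
  finally show ?thesis ..
qed

lemma comult_unit: "mMR_comult (mMR_unit 1) = tensor (mMR_unit 1) (mMR_unit 1)"
proof -
  have "mMR_comult (mMR_unit 1) (p, q) = tensor (mMR_unit 1) (mMR_unit 1) (p, q)" for p q
  proof (cases "p = [] \<and> q = []")
    case True
    then show ?thesis
      using Nil_mperms[of 0]
      unfolding comult_eq[OF unit_in_cfree]
      by (simp add: comult_index_mperms[of "[]" 0 "[]" 0] covers_0_left
          glue_def tensor_def mMR_unit_def basis_def)
  next
    case False
    \<comment> \<open>Collapsing never empties a nonempty word, so the coefficient of the empty word
      is not involved.\<close>
    then have "glue p q c \<noteq> []" for c
      by (auto simp: glue_def case_prod_unfold)
    then show ?thesis
      unfolding comult_eq[OF unit_in_cfree]
      using False by (auto simp: tensor_def mMR_unit_def basis_def)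
  qed
  then show ?thesis
    by (auto simp: fun_eq_iff)
qed

lemma unit_continuous_linear: "continuous_linear (UNIV :: unit set) all_mperms (\<lambda>c. mMR_unit (c ()))"
proof (rule continuous_linear_coeff_sum)
  show "coeff_sum UNIV (\<lambda>c. mMR_unit (c ())) (\<lambda>w. if w = [] then {()} else {}) (\<lambda>_ _. ())"
    by (auto simp: coeff_sum_def mMR_unit_def basis_def)
qed (rule unit_in_cfree)

lemma counit_continuous_linear: "continuous_linear all_mperms (UNIV :: unit set) (\<lambda>x _. mMR_counit x)"
proof (rule continuous_linear_coeff_sum)
  show "coeff_sum all_mperms (\<lambda>x _. mMR_counit x) (\<lambda>_. {()}) (\<lambda>_ _. [])"
    by (simp add: coeff_sum_def mMR_counit_def)
qed (simp add: cfree_def)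

theorem theorem4p2:
  "completed_bialgebra all_mperms mMR_mult mMR_unit mMR_comult mMR_counit"
proof unfold_locales
  show "continuous_linear (all_mperms \<times> all_mperms) all_mperms mMR_mult"
    by (rule continuous_linear_coeff_sum[OF coeff_sum_mult mult_in_cfree])
  show "continuous_linear all_mperms (all_mperms \<times> all_mperms) mMR_comult"
    by (rule continuous_linear_coeff_sum[OF coeff_sum_comult comult_in_cfree])
  show "mMR_counit (mMR_unit n) = n" for n
    by (simp add: mMR_counit_def mMR_unit_def basis_def)
qed (fact unit_continuous_linear counit_continuous_linear mult_assoc unit_left unit_right
    comult_coassoc counit_left counit_right comult_mult counit_mult comult_unit)+

end
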